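(* Let $\mathscr{C}$ be a pointed category containing a torsion theory $(\mathscr{T},\mathscr{F})$. Let $F \colon \mathsf{PreOrdGrp} \rightarrow \mathscr{C}$ be a functor satisfying the following properties: (1) $F$ is a torsion theory functor (from the pretorsion theory $(\mathsf{Grp(PreOrd)},\mathsf{ParOrdGrp})$ to the torsion theory $(\mathscr{T},\mathscr{F})$); (2) for every preordered group $(G,P_G)$ and every normal subgroup $H$ of $G$ containing $P_G$, $F$ sends the short exact sequence $$(H,P_G) \longrightarrow (G,P_G) \longrightarrow (G/H,0)$$ in $\mathsf{PreOrdGrp}$ (whose underlying group morphisms are the inclusion $H \rightarrowtail G$ and the quotient $G \twoheadrightarrow G/H$) to a short exact sequence in $\mathscr{C}$. Then there exists a unique functor $\hat{F} \colon \mathsf{Mon}_{\geq 0} \rightarrow \mathscr{C}$ such that the triangle formed by $P$, $\hat{F}$ and $F$ commutes (up to isomorphism), i.e. $\hat{F} \cdot P \cong F$, where $P \colon \mathsf{PreOrdGrp} \rightarrow \mathsf{Mon}_{\geq 0}$ is the positive cone functor.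
   Context: Groups and monoids are written additively but need not be commutative. $\mathsf{PreOrdGrp}$ is the category of preordered groups: objects are pairs $(G,P_G)$ with $G$ a group and $P_G$ a submonoid of $G$ closed under conjugation in $G$ (the positive cone); a morphism $(f,\bar f)\colon (G,P_G)\to(H,P_H)$ is a group morphism $f\colon G\to H$ with $f(P_G)\subseteq P_H$, and $\bar f\colon P_G\to P_H$ is its restriction. $\mathsf{Grp(PreOrd)}$ is the full subcategory of those $(G,P_G)$ with $P_G$ a group; $\mathsf{ParOrdGrp}$ is the full subcategory of those $(G,P_G)$ with $P_G$ reduced (the only $x\in P_G$ with $-x\in P_G$ is $0$). This pair is a pretorsion theory in $\mathsf{PreOrdGrp}$, with class of trivial objects $\mathscr{Z}=\{(G,P_G)\mid P_G=0\}$. The canonical short $\mathscr{Z}$-exact sequence of $(G,P_G)$ is $$(G,N_G)\longrightarrow (G,P_G)\longrightarrow (G/N_G,\eta_G(P_G)),$$ where $N_G=\{x\in G\mid x\in P_G \text{ and } -x\in P_G\}$ (a normal subgroup of $G$), the first arrow is $1_G$ on underlying groups, and the second is the quotient morphism $\eta_G\colon G\twoheadrightarrow G/N_G$. $\mathsf{Mon}_{\geq 0}$ is the full subcategory of the category of monoids whose objects are the monoids $M$ that are embeddable in a group and such that for all $a,b\in M$ there exist $x,y\in M$ with $a+b=b+x=y+a$. The positive cone functor $P$ is given by $P(G,P_G)=P_G$ and $P(f,\bar f)=\bar f$. In a pointed category, a short exact sequence is a composable pair $(k,q)$ such that $k$ is a kernel of $q$ and $q$ is a cokernel of $k$. A torsion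 theory in a pointed category $\mathscr{C}$ is a pair $(\mathscr{T},\mathscr{F})$ of full replete subcategories such that every morphism from an object of $\mathscr{T}$ to an object of $\mathscr{F}$ is zero, and for every object $C$ there is a short exact sequence $T\to C\to F$ with $T\in\mathscr{T}$, $F\in\mathscr{F}$. A functor $F\colon\mathsf{PreOrdGrp}\to\mathscr{C}$, where $\mathscr{C}$ is pointed with torsion theory $(\mathscr{T},\mathscr{F})$, is a torsion theory functor if: $F(G,P_G)\in\mathscr{T}$ for all $(G,P_G)\in\mathsf{Grp(PreOrd)}$; $F(G,P_G)\in\mathscr{F}$ for all $(G,P_G)\in\mathsf{ParOrdGrp}$; and for every $(G,P_G)$, $F$ sends the canonical short $\mathscr{Z}$-exact sequence of $(G,P_G)$ to a short exact sequence in $\mathscr{C}$. *)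

theory Defs
  imports "HOL-Algebra.Algebra"
begin

text \<open>
  Groups and monoids are the records of HOL-Algebra, so they are written multiplicatively.
  Their carriers are subsets of a type \<open>'u\<close>, which plays the role of the universe of small sets.
\<close>

section \<open>Categories and functors\<close>

record ('o, 'm) cat =
  Ob :: "'o set"
  Ar :: "'m set"
  Dom :: "'m \<Rightarrow> 'o"
  Cod :: "'m \<Rightarrow> 'o"
  Ident :: "'o \<Rightarrow> 'm"
  Comp :: "'m \<Rightarrow> 'm \<Rightarrow> 'm"  \<comment> \<open>\<open>Comp C g f\<close> is \<open>g\<close> after \<open>f\<close>\<close>

definition Hom :: "('o, 'm) cat \<Rightarrow> 'o \<Rightarrow> 'o \<Rightarrow> 'm set" where
  "Hom C A B = {f \<in> Ar C. Dom C f = A \<and> Cod C f = B}"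

definition is_category :: "('o, 'm) cat \<Rightarrow> bool" where
  "is_category C \<longleftrightarrow>
     (\<forall>f\<in>Ar C. Dom C f \<in> Ob C \<and> Cod C f \<in> Ob C) \<and>
     (\<forall>A\<in>Ob C. Ident C A \<in> Hom C A A) \<and>
     (\<forall>f\<in>Ar C. \<forall>g\<in>Ar C. Dom C g = Cod C f \<longrightarrow> Comp C g f \<in> Hom C (Dom C f) (Cod C g)) \<and>
     (\<forall>f\<in>Ar C. Comp C f (Ident C (Dom C f)) = f \<and> Comp C (Ident C (Cod C f)) f = f) \<and>
     (\<forall>f\<in>Ar C. \<forall>g\<in>Ar C. \<forall>h\<in>Ar C. Dom C g = Cod C f \<longrightarrow> Dom C h = Cod C g \<longrightarrow>
        Comp C h (Comp C g f) = Comp C (Comp C h g) f)"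

definition is_iso :: "('o, 'm) cat \<Rightarrow> 'm \<Rightarrow> bool" where
  "is_iso C f \<longleftrightarrow> f \<in> Ar C \<and>
     (\<exists>g\<in>Hom C (Cod C f) (Dom C f).
        Comp C g f = Ident C (Dom C f) \<and> Comp C f g = Ident C (Cod C f))"

record ('o1, 'm1, 'o2, 'm2) functor_data =
  on_ob :: "'o1 \<Rightarrow> 'o2"
  on_ar :: "'m1 \<Rightarrow> 'm2"

definition is_functor ::
  "('o1, 'm1) cat \<Rightarrow> ('o2, 'm2) cat \<Rightarrow> ('o1, 'm1, 'o2, 'm2) functor_data \<Rightarrow> bool" where
  "is_functor C D F \<longleftrightarrow>
     (\<forall>A\<in>Ob C. on_ob F A \<in> Ob D) \<and>
     (\<forall>f\<in>Ar C. on_ar F f \<in> Hom D (on_ob F (Dom C f)) (on_ob F (Cod C f))) \<and>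
     (\<forall>A\<in>Ob C. on_ar F (Ident C A) = Ident D (on_ob F A)) \<and>
     (\<forall>f\<in>Ar C. \<forall>g\<in>Ar C. Dom C g = Cod C f \<longrightarrow>
        on_ar F (Comp C g f) = Comp D (on_ar F g) (on_ar F f))"

definition functor_comp ::
  "('o2, 'm2, 'o3, 'm3) functor_data \<Rightarrow> ('o1, 'm1, 'o2, 'm2) functor_data
    \<Rightarrow> ('o1, 'm1, 'o3, 'm3) functor_data" where
  "functor_comp G F = \<lparr>on_ob = on_ob G \<circ> on_ob F, on_ar = on_ar G \<circ> on_ar F\<rparr>"

definition naturally_isomorphic ::
  "('o1, 'm1) cat \<Rightarrow> ('o2, 'm2) cat \<Rightarrow> ('o1, 'm1, 'o2, 'm2) functor_data
    \<Rightarrow> ('o1, 'm1, 'o2, 'm2) functor_data \<Rightarrow> bool" where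
  "naturally_isomorphic C D F G \<longleftrightarrow> (\<exists>\<tau>.
     (\<forall>A\<in>Ob C. \<tau> A \<in> Hom D (on_ob F A) (on_ob G A) \<and> is_iso D (\<tau> A)) \<and>
     (\<forall>f\<in>Ar C. Comp D (on_ar G f) (\<tau> (Dom C f)) = Comp D (\<tau> (Cod C f)) (on_ar F f)))"

section \<open>Pointed categories and torsion theories\<close>

definition zero_object :: "('o, 'm) cat \<Rightarrow> 'o \<Rightarrow> bool" where
  "zero_object C Z \<longleftrightarrow> Z \<in> Ob C \<and>
     (\<forall>A\<in>Ob C. (\<exists>!f. f \<in> Hom C A Z) \<and> (\<exists>!f. f \<in> Hom C Z A))"

definition pointed_category :: "('o, 'm) cat \<Rightarrow> bool" where
  "pointed_category C \<longleftrightarrow> is_category C \<and> (\<exists>Z. zero_object C Z)"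

definition zero_morphism :: "('o, 'm) cat \<Rightarrow> 'm \<Rightarrow> bool" where
  "zero_morphism C f \<longleftrightarrow> f \<in> Ar C \<and>
     (\<exists>Z. zero_object C Z \<and>
        (\<exists>g\<in>Hom C (Dom C f) Z. \<exists>h\<in>Hom C Z (Cod C f). f = Comp C h g))"

definition is_kernel :: "('o, 'm) cat \<Rightarrow> 'm \<Rightarrow> 'm \<Rightarrow> bool" where
  "is_kernel C k q \<longleftrightarrow> k \<in> Ar C \<and> q \<in> Ar C \<and> Cod C k = Dom C q \<and>
     zero_morphism C (Comp C q k) \<and>
     (\<forall>f\<in>Ar C. Cod C f = Dom C q \<longrightarrow> zero_morphism C (Comp C q f) \<longrightarrow>
        (\<exists>!h. h \<in> Hom C (Dom C f) (Dom C k) \<and> Comp C k h = f))"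

definition is_cokernel :: "('o, 'm) cat \<Rightarrow> 'm \<Rightarrow> 'm \<Rightarrow> bool" where
  "is_cokernel C q k \<longleftrightarrow> q \<in> Ar C \<and> k \<in> Ar C \<and> Cod C k = Dom C q \<and>
     zero_morphism C (Comp C q k) \<and>
     (\<forall>f\<in>Ar C. Dom C f = Cod C k \<longrightarrow> zero_morphism C (Comp C f k) \<longrightarrow>
        (\<exists>!h. h \<in> Hom C (Cod C q) (Cod C f) \<and> Comp C h q = f))"

definition short_exact :: "('o, 'm) cat \<Rightarrow> 'm \<Rightarrow> 'm \<Rightarrow> bool" where
  "short_exact C k q \<longleftrightarrow> is_kernel C k q \<and> is_cokernel C q k"

text \<open>A full subcategory is represented by its set of objects.\<close>

definition replete :: "('o, 'm) cat \<Rightarrow> 'o set \<Rightarrow> bool" where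
  "replete C S \<longleftrightarrow> S \<subseteq> Ob C \<and> (\<forall>f. is_iso C f \<longrightarrow> Dom C f \<in> S \<longrightarrow> Cod C f \<in> S)"

definition torsion_theory :: "('o, 'm) cat \<Rightarrow> 'o set \<Rightarrow> 'o set \<Rightarrow> bool" where
  "torsion_theory C \<T> \<F> \<longleftrightarrow> replete C \<T> \<and> replete C \<F> \<and>
     (\<forall>A\<in>\<T>. \<forall>B\<in>\<F>. \<forall>f\<in>Hom C A B. zero_morphism C f) \<and>
     (\<forall>A\<in>Ob C. \<exists>T\<in>\<T>. \<exists>B\<in>\<F>. \<exists>k\<in>Hom C T A. \<exists>q\<in>Hom C A B. short_exact C k q)"

section \<open>Concrete categories of sets with structure\<close>

datatype ('o, 'u) map_arrow = MapArrow (src: 'o) (app: "'u \<Rightarrow> 'u") (tgt: 'o)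

text \<open>
  In \<open>concrete_cat Obs U H\<close> the morphisms from \<open>A\<close> to \<open>B\<close> are the functions in \<open>H A B\<close>, where
  functions that agree on the underlying set \<open>U A\<close> are identified by taking only those that are
  \<open>undefined\<close> outside it.
\<close>

definition concrete_cat ::
  "'o set \<Rightarrow> ('o \<Rightarrow> 'u set) \<Rightarrow> ('o \<Rightarrow> 'o \<Rightarrow> ('u \<Rightarrow> 'u) set) \<Rightarrow> ('o, ('o, 'u) map_arrow) cat" where
  "concrete_cat Obs U H =
     \<lparr>Ob = Obs,
      Ar = {MapArrow A f B | A f B. A \<in> Obs \<and> B \<in> Obs \<and> f \<in> H A B \<and> f \<in> extensional (U A)},
      Dom = src,
      Cod = tgt,
      Ident = (\<lambda>A. MapArrow A (\<lambda>x\<in>U A. x) A),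
      Comp = (\<lambda>g f. MapArrow (src f) (compose (U (src f)) (app g) (app f)) (tgt g))\<rparr>"

section \<open>Preordered groups\<close>

type_synonym 'u preord_grp = "'u monoid \<times> 'u set"

definition preordered_group :: "'u preord_grp \<Rightarrow> bool" where
  "preordered_group = (\<lambda>(G, P). group G \<and> submonoid P G \<and>
     (\<forall>g\<in>carrier G. \<forall>x\<in>P. g \<otimes>\<^bsub>G\<^esub> x \<otimes>\<^bsub>G\<^esub> inv\<^bsub>G\<^esub> g \<in> P))"

definition PreOrdGrp :: "('u preord_grp, ('u preord_grp, 'u) map_arrow) cat" where
  "PreOrdGrp = concrete_cat {A. preordered_group A} (\<lambda>A. carrier (fst A))
     (\<lambda>A B. {f \<in> hom (fst A) (fst B). f ` snd A \<subseteq> snd B})"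

definition GrpPreOrd :: "'u preord_grp set" where
  "GrpPreOrd = {(G, P). preordered_group (G, P) \<and> group (G\<lparr>carrier := P\<rparr>)}"

definition ParOrdGrp :: "'u preord_grp set" where
  "ParOrdGrp = {(G, P). preordered_group (G, P) \<and> (\<forall>x\<in>P. inv\<^bsub>G\<^esub> x \<in> P \<longrightarrow> x = \<one>\<^bsub>G\<^esub>)}"

definition neg_part :: "'u preord_grp \<Rightarrow> 'u set" where
  "neg_part = (\<lambda>(G, P). {x \<in> carrier G. x \<in> P \<and> inv\<^bsub>G\<^esub> x \<in> P})"

text \<open>
  The library quotient \<open>G Mod H\<close> lives on the type \<open>'u set\<close>. To stay inside \<open>'u\<close>, the
  quotient group is transported along a choice of coset representatives;
  see \<open>quotient_group_iso\<close> below.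
\<close>

definition coset_rep :: "'u monoid \<Rightarrow> 'u set \<Rightarrow> 'u \<Rightarrow> 'u" where
  "coset_rep G H x = (SOME y. y \<in> H #>\<^bsub>G\<^esub> x)"

definition quotient_group :: "'u monoid \<Rightarrow> 'u set \<Rightarrow> 'u monoid" where
  "quotient_group G H =
     \<lparr>carrier = coset_rep G H ` carrier G,
      monoid.mult = (\<lambda>x y. coset_rep G H (x \<otimes>\<^bsub>G\<^esub> y)),
      one = coset_rep G H \<one>\<^bsub>G\<^esub>\<rparr>"

definition inclusion_arrow :: "'u preord_grp \<Rightarrow> 'u preord_grp \<Rightarrow> ('u preord_grp, 'u) map_arrow" where
  "inclusion_arrow A B = MapArrow A (\<lambda>x\<in>carrier (fst A). x) B"

text \<open>The last argument is the positive cone with which the quotient group is equipped.\<close>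

definition quotient_arrow :: "'u preord_grp \<Rightarrow> 'u set \<Rightarrow> 'u set \<Rightarrow> ('u preord_grp, 'u) map_arrow" where
  "quotient_arrow A H Q = MapArrow A
     (\<lambda>x\<in>carrier (fst A). coset_rep (fst A) H x) (quotient_group (fst A) H, Q)"

definition torsion_theory_functor ::
  "('o, 'm) cat \<Rightarrow> 'o set \<Rightarrow> 'o set
    \<Rightarrow> ('u preord_grp, ('u preord_grp, 'u) map_arrow, 'o, 'm) functor_data \<Rightarrow> bool" where
  "torsion_theory_functor C \<T> \<F> F \<longleftrightarrow>
     (\<forall>A\<in>GrpPreOrd. on_ob F A \<in> \<T>) \<and>
     (\<forall>A\<in>ParOrdGrp. on_ob F A \<in> \<F>) \<and>
     (\<forall>G P. (G, P) \<in> Ob PreOrdGrp \<longrightarrow>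
        short_exact C (on_ar F (inclusion_arrow (G, neg_part (G, P)) (G, P)))
                      (on_ar F 
                        (quotient_arrow (G, P) (neg_part (G, P)) (coset_rep G (neg_part (G, P)) ` P))))"

definition preserves_cone_quotients ::
  "('o, 'm) cat \<Rightarrow> ('u preord_grp, ('u preord_grp, 'u) map_arrow, 'o, 'm) functor_data \<Rightarrow> bool" where
  "preserves_cone_quotients C F \<longleftrightarrow>
     (\<forall>G P H. (G, P) \<in> Ob PreOrdGrp \<longrightarrow> H \<lhd> G \<longrightarrow> P \<subseteq> H \<longrightarrow>
        short_exact C (on_ar F (inclusion_arrow (G\<lparr>carrier := H\<rparr>, P) (G, P)))
                      (on_ar F (quotient_arrow (G, P) H {\<one>\<^bsub>quotient_group G H\<^esub>})))"

section \<open>Positive cones\<close>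

text \<open>
  It is no restriction to ask for a group on the same type: if \<open>'u\<close> is infinite, the subgroup
  generated by \<open>M\<close> in a larger group again fits into \<open>'u\<close>, and if \<open>M\<close> is finite and embeddable,
  it is itself a group.
\<close>

definition embeddable_in_group :: "'u monoid \<Rightarrow> bool" where
  "embeddable_in_group M \<longleftrightarrow>
     (\<exists>(G :: 'u monoid) f. group G \<and> f \<in> hom M G \<and> f \<one>\<^bsub>M\<^esub> = \<one>\<^bsub>G\<^esub> \<and> inj_on f (carrier M))"

definition MonGe0 :: "('u monoid, ('u monoid, 'u) map_arrow) cat" where
  "MonGe0 = concrete_cat
     {M. monoid M \<and> embeddable_in_group M \<and>
         (\<forall>a\<in>carrier M. \<forall>b\<in>carrier M. \<exists>x\<in>carrier M. \<exists>y\<in>carrier M.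
            a \<otimes>\<^bsub>M\<^esub> b = b \<otimes>\<^bsub>M\<^esub> x \<and> a \<otimes>\<^bsub>M\<^esub> b = y \<otimes>\<^bsub>M\<^esub> a)}
     carrier (\<lambda>M N. {f \<in> hom M N. f \<one>\<^bsub>M\<^esub> = \<one>\<^bsub>N\<^esub>})"

definition cone_monoid :: "'u preord_grp \<Rightarrow> 'u monoid" where
  "cone_monoid = (\<lambda>(G, P). G\<lparr>carrier := P\<rparr>)"

definition PosCone ::
  "('u preord_grp, ('u preord_grp, 'u) map_arrow, 'u monoid, ('u monoid, 'u) map_arrow) functor_data" where
  "PosCone =
     \<lparr>on_ob = cone_monoid,
      on_ar = (\<lambda>f. MapArrow (cone_monoid (src f)) (restrict (app f) (snd (src f))) (cone_monoid (tgt f)))\<rparr>"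

section \<open>Well-definedness\<close>

lemma concrete_cat_category:
  assumes "\<And>A. A \<in> Obs \<Longrightarrow> (\<lambda>x\<in>U A. x) \<in> H A A"
    and "\<And>A B f. A \<in> Obs \<Longrightarrow> B \<in> Obs \<Longrightarrow> f \<in> H A B \<Longrightarrow> f \<in> U A \<rightarrow> U B"
    and "\<And>A B E f g. A \<in> Obs \<Longrightarrow> B \<in> Obs \<Longrightarrow> E \<in> Obs \<Longrightarrow> f \<in> H A B \<Longrightarrow> g \<in> H B E
           \<Longrightarrow> compose (U A) g f \<in> H A E"
  shows "is_category (concrete_cat Obs U H)"
  unfolding is_category_def
proof (intro conjI ballI impI)
  fix f assume f: "f \<in> Ar (concrete_cat Obs U H)"
  then obtain A h B where fh: "f = MapArrow A h B" "A \<in> Obs" "B \<in> Obs" "h \<in> H A B" "h \<in> extensional (U A)"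
    by (auto simp: concrete_cat_def)
  have hU: "h \<in> U A \<rightarrow> U B" using assms(2) fh by blast
  show "Dom (concrete_cat Obs U H) f \<in> Ob (concrete_cat Obs U H)"
    "Cod (concrete_cat Obs U H) f \<in> Ob (concrete_cat Obs U H)"
    using fh by (auto simp: concrete_cat_def)
  show "Comp (concrete_cat Obs U H) f (Ident (concrete_cat Obs U H) (Dom (concrete_cat Obs U H) f)) = f"
    using fh by (auto simp: concrete_cat_def compose_def extensional_def fun_eq_iff)
  show "Comp (concrete_cat Obs U H) (Ident (concrete_cat Obs U H) (Cod (concrete_cat Obs U H) f)) f = f"
    using fh hU by (auto simp: concrete_cat_def compose_def extensional_def fun_eq_iff)
  fix g assume g: "g \<in> Ar (concrete_cat Obs U H)"
    and gf: "Dom (concrete_cat Obs U H) g = Cod (concrete_cat Obs U H) f"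
  then obtain k E where gk: "g = MapArrow B k E" "E \<in> Obs" "k \<in> H B E" "k \<in> extensional (U B)"
    using fh by (auto simp: concrete_cat_def)
  show "Comp (concrete_cat Obs U H) g f
      \<in> Hom (concrete_cat Obs U H) (Dom (concrete_cat Obs U H) f) (Cod (concrete_cat Obs U H) g)"
    using fh gk assms(3)[OF fh(2,3) gk(2) fh(4) gk(3)] by (auto simp: concrete_cat_def Hom_def)
  fix h' assume h': "h' \<in> Ar (concrete_cat Obs U H)"
    "Dom (concrete_cat Obs U H) h' = Cod (concrete_cat Obs U H) g"
  show "Comp (concrete_cat Obs U H) h' (Comp (concrete_cat Obs U H) g f)
      = Comp (concrete_cat Obs U H) (Comp (concrete_cat Obs U H) h' g) f"
    using fh gk h' hU by (auto simp: concrete_cat_def compose_def fun_eq_iff)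
next
  fix A assume "A \<in> Ob (concrete_cat Obs U H)"
  then show "Ident (concrete_cat Obs U H) A \<in> Hom (concrete_cat Obs U H) A A"
    using assms(1) by (auto simp: concrete_cat_def Hom_def)
qed

lemma PreOrdGrp_category: "is_category PreOrdGrp"
  unfolding PreOrdGrp_def
proof (rule concrete_cat_category, goal_cases)
  case (1 A)
  then show ?case
    using submonoid.subset by (fastforce simp: preordered_group_def hom_def
        group.is_monoid monoid.m_closed split: prod.splits)
next
  case (2 A B f)
  then show ?case by (auto simp: hom_def)
next
  case (3 A B E f g)
  have "snd A \<subseteq> carrier (fst A)"
    using 3(1) submonoid.subset by (fastforce simp: preordered_group_def split: prod.splits)
  moreover have "compose (carrier (fst A)) g f \<in> hom (fst A) (fst E)"
    using 3 by (auto simp: preordered_group_def intro!: group.hom_compose split: prod.splits)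
  ultimately show ?case using 3 by (auto simp: compose_def)
qed

lemma MonGe0_category: "is_category MonGe0"
  unfolding MonGe0_def
proof (rule concrete_cat_category, goal_cases)
  case (1 A)
  then show ?case by (auto simp: hom_def monoid.m_closed)
next
  case (2 A B f)
  then show ?case by (auto simp: hom_def)
next
  case (3 A B E f g)
  then show ?case by (auto simp: compose_def hom_def monoid.m_closed monoid.one_closed Pi_iff)
qed

lemma PosCone_functor: "is_functor PreOrdGrp MonGe0 PosCone"
proof -
  have ob: "cone_monoid A \<in> Ob MonGe0" if "preordered_group A" for A :: "'u preord_grp"
  proof -
    obtain G P where A: "A = (G, P)" by fastforce
    with that have G: "group G" and P: "submonoid P G"
      and conj: "\<And>g x. g \<in> carrier G \<Longrightarrow> x \<in> P \<Longrightarrow> g \<otimes>\<^bsub>G\<^esub> x \<otimes>\<^bsub>G\<^esub> inv\<^bsub>G\<^esub> g \<in> P"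
      by (auto simp: preordered_group_def)
    interpret G: group G by fact
    have PG: "P \<subseteq> carrier G" using P by (rule submonoid.subset)
    have "monoid (G\<lparr>carrier := P\<rparr>)"
      using P G.is_monoid by (rule submonoid.submonoid_is_monoid)
    moreover have "embeddable_in_group (G\<lparr>carrier := P\<rparr>)"
      unfolding embeddable_in_group_def
      by (rule exI[of _ G], rule exI[of _ "\<lambda>x. x"]) (use PG in \<open>auto simp: hom_def\<close>)
    moreover have "\<exists>x\<in>P. \<exists>y\<in>P. a \<otimes>\<^bsub>G\<^esub> b = b \<otimes>\<^bsub>G\<^esub> x \<and> a \<otimes>\<^bsub>G\<^esub> b = y \<otimes>\<^bsub>G\<^esub> a"
      if "a \<in> P" "b \<in> P" for a b
    proof (intro bexI conjI)
      have c: "a \<in> carrier G" "b \<in> carrier G" using that PG by auto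
      show "a \<otimes>\<^bsub>G\<^esub> b = b \<otimes>\<^bsub>G\<^esub> (inv\<^bsub>G\<^esub> b \<otimes>\<^bsub>G\<^esub> a \<otimes>\<^bsub>G\<^esub> b)"
        using c by (metis G.inv_closed G.m_assoc G.m_closed G.r_inv G.l_one)
      show "a \<otimes>\<^bsub>G\<^esub> b = a \<otimes>\<^bsub>G\<^esub> b \<otimes>\<^bsub>G\<^esub> inv\<^bsub>G\<^esub> a \<otimes>\<^bsub>G\<^esub> a"
        using c by (simp add: G.m_assoc)
      show "inv\<^bsub>G\<^esub> b \<otimes>\<^bsub>G\<^esub> a \<otimes>\<^bsub>G\<^esub> b \<in> P"
        using conj[of "inv\<^bsub>G\<^esub> b" a] c that by simp
      show "a \<otimes>\<^bsub>G\<^esub> b \<otimes>\<^bsub>G\<^esub> inv\<^bsub>G\<^esub> a \<in> P" using conj[of a b] c that by simp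
    qed
    ultimately show ?thesis by (auto simp: MonGe0_def concrete_cat_def cone_monoid_def A)
  qed
  have sub: "snd A \<subseteq> carrier (fst A)" if "preordered_group A" for A :: "'u preord_grp"
    using that submonoid.subset by (fastforce simp: preordered_group_def split: prod.splits)
  have one: "f \<one>\<^bsub>G\<^esub> = \<one>\<^bsub>H\<^esub>" "\<one>\<^bsub>G\<^esub> \<in> P"
    if "preordered_group (G, P)" "preordered_group (H, Q)" "f \<in> hom G H" for G H :: "'u monoid" and f P Q
    using that by (auto simp: preordered_group_def hom_one submonoid.one_closed)
  show ?thesis
    unfolding is_functor_def
  proof (intro conjI ballI impI)
    fix A assume "A \<in> Ob (PreOrdGrp :: ('u preord_grp, _) cat)"
    then have A: "preordered_group A" by (simp add: PreOrdGrp_def concrete_cat_def)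
    show "on_ob PosCone A \<in> Ob MonGe0" using ob[OF A] by (simp add: PosCone_def)
    show "on_ar PosCone (Ident PreOrdGrp A) = Ident MonGe0 (on_ob PosCone A)"
      using sub[OF A] by (auto simp: PosCone_def PreOrdGrp_def MonGe0_def concrete_cat_def
          cone_monoid_def restrict_def fun_eq_iff split: prod.splits)
  next
    fix f assume "f \<in> Ar (PreOrdGrp :: ('u preord_grp, _) cat)"
    then obtain G P h H Q where f: "f = MapArrow (G, P) h (H, Q)"
      and P: "preordered_group (G, P)" and Q: "preordered_group (H, Q)"
      and h: "h \<in> hom G H" "h ` P \<subseteq> Q"
      by (auto simp: PreOrdGrp_def concrete_cat_def)
    have mc: "x \<otimes>\<^bsub>G\<^esub> y \<in> P" if "x \<in> P" "y \<in> P" for x y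
      using P that by (auto simp: preordered_group_def submonoid.m_closed)
    have "restrict h P \<in> hom (G\<lparr>carrier := P\<rparr>) (H\<lparr>carrier := Q\<rparr>)"
    proof (rule homI)
      fix x assume x: "x \<in> carrier (G\<lparr>carrier := P\<rparr>)"
      then show "restrict h P x \<in> carrier (H\<lparr>carrier := Q\<rparr>)" using h by auto
      fix y assume "y \<in> carrier (G\<lparr>carrier := P\<rparr>)"
      with x show "restrict h P (x \<otimes>\<^bsub>G\<lparr>carrier := P\<rparr>\<^esub> y)
          = restrict h P x \<otimes>\<^bsub>H\<lparr>carrier := Q\<rparr>\<^esub> restrict h P y"
        using hom_mult[OF h(1), of x y] sub[OF P] mc[of x y] by auto
    qed
    then show "on_ar PosCone f \<in> Hom MonGe0 (on_ob PosCone (Dom PreOrdGrp f)) (on_ob PosCone (Cod PreOrdGrp f))"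
      using one[OF P Q h(1)] ob[OF P] ob[OF Q]
      by (auto simp: Hom_def PosCone_def f MonGe0_def PreOrdGrp_def concrete_cat_def cone_monoid_def)
    fix g assume "g \<in> Ar (PreOrdGrp :: ('u preord_grp, _) cat)" "Dom PreOrdGrp g = Cod PreOrdGrp f"
    then show "on_ar PosCone (Comp PreOrdGrp g f) = Comp MonGe0 (on_ar PosCone g) (on_ar PosCone f)"
      using h sub[OF P] f
      by (auto simp: PosCone_def MonGe0_def PreOrdGrp_def concrete_cat_def cone_monoid_def
          compose_def fun_eq_iff)
  qed
qed

lemma neg_part_normal:
  assumes "preordered_group (G, P)"
  shows "neg_part (G, P) \<lhd> G"
proof -
  have P: "submonoid P G"
    and conj: "\<And>g x. g \<in> carrier G \<Longrightarrow> x \<in> P \<Longrightarrow> g \<otimes>\<^bsub>G\<^esub> x \<otimes>\<^bsub>G\<^esub> inv\<^bsub>G\<^esub> g \<in> P"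
    using assms by (auto simp: preordered_group_def)
  interpret G: group G using assms by (auto simp: preordered_group_def)
  have "subgroup (neg_part (G, P)) G"
    using P by (auto simp: neg_part_def G.inv_mult_group intro!: G.subgroupI
        submonoid.m_closed[OF P] dest: submonoid.one_closed)
      (metis G.inv_one G.one_closed empty_iff mem_Collect_eq submonoid.one_closed)
  moreover have "g \<otimes>\<^bsub>G\<^esub> x \<otimes>\<^bsub>G\<^esub> inv\<^bsub>G\<^esub> g \<in> neg_part (G, P)"
    if "g \<in> carrier G" "x \<in> neg_part (G, P)" for g x
    using that conj[of g x] conj[of g "inv\<^bsub>G\<^esub> x"]
    by (auto simp: neg_part_def G.inv_mult_group G.m_assoc)
  ultimately show ?thesis by (simp add: G.normal_inv_iff)
qed

lemma coset_rep_coset: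
  assumes "H \<lhd> G" "x \<in> carrier G"
  shows "coset_rep G H x \<in> carrier G" "H #>\<^bsub>G\<^esub> coset_rep G H x = H #>\<^bsub>G\<^esub> x"
proof -
  interpret normal H G by fact
  have "x \<in> H #>\<^bsub>G\<^esub> x" using assms(2) is_subgroup by (simp add: rcos_self)
  then have *: "coset_rep G H x \<in> H #>\<^bsub>G\<^esub> x" unfolding coset_rep_def by (rule someI)
  then show "coset_rep G H x \<in> carrier G"
    using assms(2) r_coset_subset_G subset by blast
  show "H #>\<^bsub>G\<^esub> coset_rep G H x = H #>\<^bsub>G\<^esub> x"
    using repr_independence[OF * assms(2)] is_subgroup by simp
qed

lemma quotient_group_iso:
  assumes "H \<lhd> G"
  shows "(\<lambda>x. H #>\<^bsub>G\<^esub> x) \<in> iso (quotient_group G H) (G Mod H)"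
proof -
  interpret normal H G by fact
  have eq: "coset_rep G H x = coset_rep G H y" if "H #>\<^bsub>G\<^esub> x = H #>\<^bsub>G\<^esub> y" for x y
    using that by (simp add: coset_rep_def)
  note rep = coset_rep_coset[OF assms]
  have "(\<lambda>x. H #>\<^bsub>G\<^esub> x) \<in> hom (quotient_group G H) (G Mod H)"
  proof (rule homI)
    fix x assume "x \<in> carrier (quotient_group G H)"
    then have "x \<in> carrier G" using rep(1) by (auto simp: quotient_group_def)
    then show "H #>\<^bsub>G\<^esub> x \<in> carrier (G Mod H)" by (auto simp: FactGroup_def RCOSETS_def)
    fix y assume "y \<in> carrier (quotient_group G H)"
    then have "y \<in> carrier G" using rep(1) by (auto simp: quotient_group_def)
    with \<open>x \<in> carrier G\<close>
    show "H #>\<^bsub>G\<^esub> (x \<otimes>\<^bsub>quotient_group G H\<^esub> y) = (H #>\<^bsub>G\<^esub> x) \<otimes>\<^bsub>G Mod H\<^esub> (H #>\<^bsub>G\<^esub> y)"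
      by (simp add: quotient_group_def FactGroup_def rep(2) rcos_sum)
  qed
  moreover have "bij_betw (\<lambda>x. H #>\<^bsub>G\<^esub> x) (coset_rep G H ` carrier G) (rcosets\<^bsub>G\<^esub> H)"
    unfolding bij_betw_def
  proof
    show "inj_on (\<lambda>x. H #>\<^bsub>G\<^esub> x) (coset_rep G H ` carrier G)"
    proof (rule inj_onI, elim imageE)
      fix x y a b
      assume "H #>\<^bsub>G\<^esub> x = H #>\<^bsub>G\<^esub> y" "x = coset_rep G H a" "a \<in> carrier G"
        "y = coset_rep G H b" "b \<in> carrier G"
      then show "x = y" using rep(2)[of a] rep(2)[of b] eq[of a b] by simp
    qed
    show "(\<lambda>x. H #>\<^bsub>G\<^esub> x) ` coset_rep G H ` carrier G = rcosets\<^bsub>G\<^esub> H"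
      by (auto simp: rep RCOSETS_def image_image)
  qed
  ultimately show ?thesis by (simp add: iso_def quotient_group_def FactGroup_def)
qed

lemma coset_rep_hom:
  assumes "H \<lhd> G"
  shows "coset_rep G H \<in> hom G (quotient_group G H)"
proof -
  interpret normal H G by fact
  note rep = coset_rep_coset[OF assms]
  have eq: "coset_rep G H x = coset_rep G H y" if "H #>\<^bsub>G\<^esub> x = H #>\<^bsub>G\<^esub> y" for x y
    using that by (simp add: coset_rep_def)
  have mult: "coset_rep G H (coset_rep G H x \<otimes>\<^bsub>G\<^esub> coset_rep G H y) = coset_rep G H (x \<otimes>\<^bsub>G\<^esub> y)"
    if "x \<in> carrier G" "y \<in> carrier G" for x y
    using rcos_sum[OF rep(1)[OF that(1)] rep(1)[OF that(2)]] rcos_sum[OF that] rep(2) that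
    by (intro eq) simp
  show ?thesis
    by (auto simp: hom_def quotient_group_def mult)
qed

lemma coset_rep_group_hom:
  assumes "H \<lhd> G"
  shows "group_hom G (quotient_group G H) (coset_rep G H)"
proof -
  interpret normal H G by fact
  have "group ((quotient_group G H)\<lparr>carrier := coset_rep G H ` carrier G, one := coset_rep G H \<one>\<^bsub>G\<^esub>\<rparr>)"
    using coset_rep_hom[OF assms] by (rule hom_imp_img_group)
  then have "group (quotient_group G H)" by (simp add: quotient_group_def)
  then show ?thesis
    using coset_rep_hom[OF assms] is_group by (simp add: group_hom_def group_hom_axioms_def)
qed

lemma quotient_cone:
  assumes A: "preordered_group (G, P)" and h: "group_hom G Q r" and surj: "carrier Q = r ` carrier G"
  shows "preordered_group (Q, r ` P)"
proof -
  interpret group_hom G Q r by fact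
  have P: "submonoid P G" and PG: "P \<subseteq> carrier G"
    and conj: "\<And>g x. g \<in> carrier G \<Longrightarrow> x \<in> P \<Longrightarrow> g \<otimes>\<^bsub>G\<^esub> x \<otimes>\<^bsub>G\<^esub> inv\<^bsub>G\<^esub> g \<in> P"
    using A submonoid.subset by (auto simp: preordered_group_def)
  have "submonoid (r ` P) Q"
  proof
    show "r ` P \<subseteq> carrier Q" using PG surj by auto
    show "\<one>\<^bsub>Q\<^esub> \<in> r ` P" using imageI[OF submonoid.one_closed[OF P], of r] by simp
    fix x y assume "x \<in> r ` P" "y \<in> r ` P"
    then obtain a b where ab: "a \<in> P" "b \<in> P" "x = r a" "y = r b" by auto
    then have "r (a \<otimes>\<^bsub>G\<^esub> b) = x \<otimes>\<^bsub>Q\<^esub> y" using subsetD[OF PG] by simp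
    then show "x \<otimes>\<^bsub>Q\<^esub> y \<in> r ` P"
      using imageI[OF submonoid.m_closed[OF P ab(1,2)], of r] by metis
  qed
  moreover have "g \<otimes>\<^bsub>Q\<^esub> x \<otimes>\<^bsub>Q\<^esub> inv\<^bsub>Q\<^esub> g \<in> r ` P" if g: "g \<in> carrier Q" and x: "x \<in> r ` P" for g x
  proof -
    obtain a b where ab: "a \<in> carrier G" "g = r a" "b \<in> P" "x = r b"
      using g x surj by auto
    then have "r (a \<otimes>\<^bsub>G\<^esub> b \<otimes>\<^bsub>G\<^esub> inv\<^bsub>G\<^esub> a) = g \<otimes>\<^bsub>Q\<^esub> x \<otimes>\<^bsub>Q\<^esub> inv\<^bsub>Q\<^esub> g"
      using subsetD[OF PG] by simp
    then show ?thesis using imageI[OF conj[OF ab(1) ab(3)], of r] by metis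
  qed
  ultimately show ?thesis using H.is_group by (simp add: preordered_group_def)
qed

lemma quotient_arrow_PreOrdGrp:
  assumes A: "preordered_group (G, P)" and H: "H \<lhd> G"
  shows "quotient_arrow (G, P) H (coset_rep G H ` P)
    \<in> Hom PreOrdGrp (G, P) (quotient_group G H, coset_rep G H ` P)"
proof -
  interpret normal H G by fact
  have PG: "P \<subseteq> carrier G" using A submonoid.subset by (auto simp: preordered_group_def)
  have "preordered_group (quotient_group G H, coset_rep G H ` P)"
    by (rule quotient_cone[OF A coset_rep_group_hom[OF H]]) (simp add: quotient_group_def)
  moreover have "restrict (coset_rep G H) (carrier G) \<in> hom G (quotient_group G H)"
    using coset_rep_hom[OF H] by (auto simp: hom_def)
  ultimately show ?thesis using A PG
    by (auto simp: Hom_def quotient_arrow_def PreOrdGrp_def concrete_cat_def)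
qed

lemma coset_rep_trivial_cone:
  assumes "preordered_group (G, P)" "H \<lhd> G" "P \<subseteq> H"
  shows "coset_rep G H ` P = {\<one>\<^bsub>quotient_group G H\<^esub>}"
proof -
  interpret normal H G by fact
  have coset: "H #>\<^bsub>G\<^esub> x = H" if "x \<in> H" for x
    using that subset by (intro coset_join2 is_subgroup) auto
  have rep: "coset_rep G H x = coset_rep G H \<one>\<^bsub>G\<^esub>" if "x \<in> P" for x
    unfolding coset_rep_def using coset[of x] coset[OF subgroup.one_closed[OF is_subgroup]] assms(3) that by auto
  have "\<one>\<^bsub>G\<^esub> \<in> P" using assms(1) by (auto simp: preordered_group_def submonoid.one_closed)
  then have "coset_rep G H ` P = {coset_rep G H \<one>\<^bsub>G\<^esub>}"
    using rep by (metis image_cong image_constant)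
  then show ?thesis by (simp add: quotient_group_def)
qed

lemma inclusion_arrow_normal_PreOrdGrp:
  assumes A: "preordered_group (G, P)" and H: "H \<lhd> G" and PH: "P \<subseteq> H"
  shows "inclusion_arrow (G\<lparr>carrier := H\<rparr>, P) (G, P) \<in> Hom PreOrdGrp (G\<lparr>carrier := H\<rparr>, P) (G, P)"
proof -
  interpret normal H G by fact
  have P: "submonoid P G"
    and conj: "\<And>g x. g \<in> carrier G \<Longrightarrow> x \<in> P \<Longrightarrow> g \<otimes>\<^bsub>G\<^esub> x \<otimes>\<^bsub>G\<^esub> inv\<^bsub>G\<^esub> g \<in> P"
    using A by (auto simp: preordered_group_def)
  have "submonoid P (G\<lparr>carrier := H\<rparr>)"
    using submonoid.m_closed[OF P] submonoid.one_closed[OF P] PH by (intro submonoid.intro) simp_all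
  moreover have "group (G\<lparr>carrier := H\<rparr>)" by (rule subgroup.subgroup_is_group[OF is_subgroup is_group])
  ultimately have "preordered_group (G\<lparr>carrier := H\<rparr>, P)"
    using conj[OF subsetD[OF subset]]
    by (simp add: preordered_group_def m_inv_consistent[OF is_subgroup])
  moreover have "restrict (\<lambda>x. x) H \<in> hom (G\<lparr>carrier := H\<rparr>) G"
    by (rule homI) (use subset subgroup.m_closed[OF is_subgroup] in \<open>simp_all add: subset_iff\<close>)
  ultimately show ?thesis using A PH
    by (auto simp: Hom_def inclusion_arrow_def PreOrdGrp_def concrete_cat_def)
qed

lemma inclusion_arrow_cone_PreOrdGrp:
  assumes "preordered_group (G, P)" "preordered_group (G, Q)" "P \<subseteq> Q"
  shows "inclusion_arrow (G, P) (G, Q) \<in> Hom PreOrdGrp (G, P) (G, Q)"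
proof -
  have "P \<subseteq> carrier G" "group G" using assms(1) submonoid.subset by (auto simp: preordered_group_def)
  moreover from this have "restrict (\<lambda>x. x) (carrier G) \<in> hom G G"
    by (auto intro!: homI simp: group.is_monoid monoid.m_closed)
  ultimately show ?thesis using assms
    by (auto simp: Hom_def inclusion_arrow_def PreOrdGrp_def concrete_cat_def)
qed

lemma neg_part_preordered_group:
  assumes "preordered_group (G, P)"
  shows "preordered_group (G, neg_part (G, P))"
proof -
  interpret normal "neg_part (G, P)" G by (rule neg_part_normal[OF assms])
  show ?thesis
    unfolding preordered_group_def prod.case
    by (intro conjI ballI is_group subgroup.subgroup_is_submonoid[OF is_subgroup] inv_op_closed2)
qed

lemma inclusion_arrow_neg_part_PreOrdGrp:
  assumes "preordered_group (G, P)"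
  shows "inclusion_arrow (G, neg_part (G, P)) (G, P) \<in> Hom PreOrdGrp (G, neg_part (G, P)) (G, P)"
  using assms
  by (intro inclusion_arrow_cone_PreOrdGrp neg_part_preordered_group) (auto simp: neg_part_def)

end

theory Submission
  imports Defs
begin

text \<open>
  If the group of a preordered group \<open>Y\<close> consists of the fractions \<open>a b\<inverse>\<close> of elements of its cone,
  then every monoid homomorphism from the cone of \<open>Y\<close> to the cone of \<open>A\<close> extends uniquely to a
  morphism \<open>Y \<rightarrow> A\<close>. Every object of \<open>MonGe0\<close> is isomorphic to such a cone, so \<open>PosCone\<close> has a
  left adjoint \<open>\<Phi>\<close> with invertible unit, and any factorisation of \<open>F\<close> through \<open>PosCone\<close> has to be
  isomorphic to \<open>F \<circ> \<Phi>\<close>. Conversely \<open>F \<circ> \<Phi>\<close> is a factorisation as soon as \<open>F\<close> inverts the counit,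
  which is up to isomorphism the inclusion \<open>(H, P) \<rightarrow> (G, P)\<close> of the group \<open>H\<close> of fractions of \<open>P\<close>.
  Since \<open>H\<close> is normal, \<open>F\<close> sends this inclusion to a kernel of a morphism into \<open>F (G/H, 0)\<close>.
  That object is both torsion and torsion-free, hence zero, and a kernel of a zero morphism is
  invertible.
\<close>

section \<open>Factorisation through a coreflection\<close>

locale categ =
  fixes C :: "('o, 'm) cat"
  assumes cat: "is_category C"
begin

lemma Ar_Hom: "f \<in> Ar C \<Longrightarrow> f \<in> Hom C (Dom C f) (Cod C f)"
  by (simp add: Hom_def)

lemma Hom_D:
  assumes "f \<in> Hom C A B"
  shows "f \<in> Ar C \<and> Dom C f = A \<and> Cod C f = B \<and> A \<in> Ob C \<and> B \<in> Ob C"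
proof -
  have "\<forall>f\<in>Ar C. Dom C f \<in> Ob C \<and> Cod C f \<in> Ob C"
    using cat unfolding is_category_def by (elim conjE)
  then show ?thesis using assms unfolding Hom_def by blast
qed

lemma comp_Hom:
  assumes "g \<in> Hom C B E" "f \<in> Hom C A B"
  shows "Comp C g f \<in> Hom C A E"
proof -
  have "\<forall>f\<in>Ar C. \<forall>g\<in>Ar C. Dom C g = Cod C f \<longrightarrow> Comp C g f \<in> Hom C (Dom C f) (Cod C g)"
    using cat unfolding is_category_def by (elim conjE)
  then show ?thesis using Hom_D[OF assms(1)] Hom_D[OF assms(2)] by metis
qed

lemma ident_Hom:
  assumes "A \<in> Ob C"
  shows "Ident C A \<in> Hom C A A"
proof -
  have "\<forall>A\<in>Ob C. Ident C A \<in> Hom C A A" using cat unfolding is_category_def by (elim conjE)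
  then show ?thesis using assms by blast
qed

lemma comp_ident: "f \<in> Hom C A B \<Longrightarrow> Comp C f (Ident C A) = f"
  and ident_comp: "f \<in> Hom C A B \<Longrightarrow> Comp C (Ident C B) f = f"
proof -
  have "\<forall>f\<in>Ar C. Comp C f (Ident C (Dom C f)) = f \<and> Comp C (Ident C (Cod C f)) f = f"
    using cat unfolding is_category_def by (elim conjE)
  then show "f \<in> Hom C A B \<Longrightarrow> Comp C f (Ident C A) = f"
    "f \<in> Hom C A B \<Longrightarrow> Comp C (Ident C B) f = f"
    using Hom_D[of f A B] by auto
qed

lemma assoc:
  assumes "h \<in> Hom C D E" "g \<in> Hom C B D" "f \<in> Hom C A B"
  shows "Comp C h (Comp C g f) = Comp C (Comp C h g) f"
proof -
  have "\<forall>f\<in>Ar C. \<forall>g\<in>Ar C. \<forall>h\<in>Ar C. Dom C g = Cod C f \<longrightarrow> Dom C h = Cod C g \<longrightarrow>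
      Comp C h (Comp C g f) = Comp C (Comp C h g) f"
    using cat unfolding is_category_def by (elim conjE)
  then show ?thesis using Hom_D[OF assms(1)] Hom_D[OF assms(2)] Hom_D[OF assms(3)] by simp
qed

lemma isoI:
  assumes "f \<in> Hom C A B" "g \<in> Hom C B A" "Comp C g f = Ident C A" "Comp C f g = Ident C B"
  shows "is_iso C f"
  unfolding is_iso_def using Hom_D[OF assms(1)] assms(2-) by (intro conjI bexI[of _ g]) simp_all

lemma iso_inverse:
  assumes "is_iso C f" "f \<in> Hom C A B"
  obtains g where "g \<in> Hom C B A" "Comp C g f = Ident C A" "Comp C f g = Ident C B" "is_iso C g"
proof -
  obtain g where "g \<in> Hom C B A" "Comp C g f = Ident C A" "Comp C f g = Ident C B"
    using assms(1) Hom_D[OF assms(2)] by (auto simp: is_iso_def)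
  then show thesis using isoI[OF _ assms(2)] that by simp
qed

lemma ident_iso: "A \<in> Ob C \<Longrightarrow> is_iso C (Ident C A)"
  using isoI[OF ident_Hom ident_Hom] comp_ident[OF ident_Hom] by simp

lemma comp_iso:
  assumes g: "is_iso C g" "g \<in> Hom C B E" and f: "is_iso C f" "f \<in> Hom C A B"
  shows "is_iso C (Comp C g f)"
proof -
  obtain f' where f': "f' \<in> Hom C B A" "Comp C f' f = Ident C A" "Comp C f f' = Ident C B"
    using iso_inverse[OF f] by metis
  obtain g' where g': "g' \<in> Hom C E B" "Comp C g' g = Ident C B" "Comp C g g' = Ident C E"
    using iso_inverse[OF g] by metis
  show ?thesis
  proof (rule isoI)
    show "Comp C g f \<in> Hom C A E" "Comp C f' g' \<in> Hom C E A"
      by (rule comp_Hom[OF g(2) f(2)], rule comp_Hom[OF f'(1) g'(1)])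
    have "Comp C (Comp C f' g') (Comp C g f) = Comp C f' (Comp C (Comp C g' g) f)"
      using assoc[OF f'(1) g'(1) comp_Hom[OF g(2) f(2)]] assoc[OF g'(1) g(2) f(2)] by simp
    then show "Comp C (Comp C f' g') (Comp C g f) = Ident C A"
      using f'(2) g'(2) ident_comp[OF f(2)] by simp
    have "Comp C (Comp C g f) (Comp C f' g') = Comp C g (Comp C (Comp C f f') g')"
      using assoc[OF g(2) f(2) comp_Hom[OF f'(1) g'(1)]] assoc[OF f(2) f'(1) g'(1)] by simp
    then show "Comp C (Comp C g f) (Comp C f' g') = Ident C E"
      using f'(3) g'(3) ident_comp[OF g'(1)] by simp
  qed
qed

text \<open>When \<open>q\<close> is zero, the identity of its domain is annihilated by
  \<open>q\<close> and so lifts through \<open>k\<close>. The lift is a right inverse of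
  \<open>k\<close>, and uniqueness of lifts makes it a left inverse as well.\<close>

lemma kernel_of_zero_iso:
  assumes kq: "is_kernel C k q" and zero: "zero_morphism C q"
  shows "is_iso C k"
proof -
  let ?K = "Dom C k" and ?A = "Dom C q"
  have q: "q \<in> Hom C ?A (Cod C q)" and k: "k \<in> Hom C ?K ?A" and qk: "zero_morphism C (Comp C q k)"
    and lift: "\<forall>f\<in>Ar C. Cod C f = ?A \<longrightarrow> zero_morphism C (Comp C q f) \<longrightarrow>
        (\<exists>!h. h \<in> Hom C (Dom C f) ?K \<and> Comp C k h = f)"
    using kq unfolding is_kernel_def Hom_def by simp_all
  have lift': "\<exists>!h. h \<in> Hom C B ?K \<and> Comp C k h = f"
    if "f \<in> Hom C B ?A" "zero_morphism C (Comp C q f)" for f B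
    using lift Hom_D[OF that(1)] that(2) by metis
  have i: "Ident C ?A \<in> Hom C ?A ?A" and ik: "Ident C ?K \<in> Hom C ?K ?K"
    using ident_Hom Hom_D[OF k] by simp_all
  obtain h where h: "h \<in> Hom C ?A ?K" "Comp C k h = Ident C ?A"
    using lift'[OF i] comp_ident[OF q] zero by auto
  have "Comp C k (Comp C h k) = k" using assoc[OF k h(1) k] h(2) ident_comp[OF k] by simp
  \<comment> \<open>Both sides are lifts of \<open>k\<close> through \<open>k\<close> itself, so
    they coincide.\<close>
  then have "Comp C h k = Ident C ?K"
    using lift'[OF k qk] ik comp_Hom[OF h(1) k] comp_ident[OF k] by blast
  then show ?thesis using isoI k h by blast
qed

text \<open>Precomposing with \<open>f\<close> a factorisation of the identity of \<open>B\<close>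
  through a zero object yields such a factorisation of \<open>f\<close>.\<close>

lemma zero_morphism_codI:
  assumes f: "f \<in> Hom C A B" and B: "zero_morphism C (Ident C B)"
  shows "zero_morphism C f"
proof -
  have iB: "Ident C B \<in> Hom C B B" using f Hom_D ident_Hom by blast
  then obtain Z g h where Z: "zero_object C Z" and gh: "g \<in> Hom C B Z" "h \<in> Hom C Z B" "Ident C B = Comp C h g"
    using B Hom_D[OF iB] unfolding zero_morphism_def by auto
  have "f = Comp C h (Comp C g f)"
    using assoc[OF gh(2,1) f] ident_comp[OF f] gh(3) by simp
  moreover have "Comp C g f \<in> Hom C A Z" using comp_Hom gh f by blast
  ultimately show ?thesis using Z gh(2) Hom_D[OF f] unfolding zero_morphism_def by auto
qed

end

section \<open>Functors and natural isomorphisms\<close>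

lemma functor_ob: "is_functor C D F \<Longrightarrow> A \<in> Ob C \<Longrightarrow> on_ob F A \<in> Ob D"
  unfolding is_functor_def by blast

lemma functor_ident:
  "is_functor C D F \<Longrightarrow> A \<in> Ob C \<Longrightarrow> on_ar F (Ident C A) = Ident D (on_ob F A)"
  unfolding is_functor_def by blast

lemma functor_Hom:
  assumes "is_functor C D F" "f \<in> Hom C A B"
  shows "on_ar F f \<in> Hom D (on_ob F A) (on_ob F B)"
proof -
  have "\<forall>f\<in>Ar C. on_ar F f \<in> Hom D (on_ob F (Dom C f)) (on_ob F (Cod C f))"
    using assms(1) unfolding is_functor_def by (elim conjE)
  then show ?thesis using assms(2) by (auto simp: Hom_def)
qed

lemma functor_comp_ar:
  assumes "is_functor C D F" "g \<in> Hom C B E" "f \<in> Hom C A B"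
  shows "on_ar F (Comp C g f) = Comp D (on_ar F g) (on_ar F f)"
proof -
  have "\<forall>f\<in>Ar C. \<forall>g\<in>Ar C. Dom C g = Cod C f \<longrightarrow>
      on_ar F (Comp C g f) = Comp D (on_ar F g) (on_ar F f)"
    using assms(1) unfolding is_functor_def by (elim conjE)
  then show ?thesis using assms(2,3) by (auto simp: Hom_def)
qed

lemma functor_iso:
  assumes "is_category C" "is_category D" and F: "is_functor C D F" and "is_iso C f"
  shows "is_iso D (on_ar F f)"
proof -
  interpret C: categ C by (rule categ.intro) fact
  interpret D: categ D by (rule categ.intro) fact
  have f: "f \<in> Hom C (Dom C f) (Cod C f)" using assms(4) C.Ar_Hom by (simp add: is_iso_def)
  obtain g where g: "g \<in> Hom C (Cod C f) (Dom C f)"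
    "Comp C g f = Ident C (Dom C f)" "Comp C f g = Ident C (Cod C f)"
    using C.iso_inverse[OF assms(4) f] .
  have ob: "Dom C f \<in> Ob C" "Cod C f \<in> Ob C" using C.Hom_D[OF f] by simp_all
  show ?thesis
  proof (rule D.isoI[OF functor_Hom[OF F f] functor_Hom[OF F g(1)]])
    show "Comp D (on_ar F g) (on_ar F f) = Ident D (on_ob F (Dom C f))"
      using functor_comp_ar[OF F g(1) f] g(2) functor_ident[OF F ob(1)] by simp
    show "Comp D (on_ar F f) (on_ar F g) = Ident D (on_ob F (Cod C f))"
      using functor_comp_ar[OF F f g(1)] g(3) functor_ident[OF F ob(2)] by simp
  qed
qed

text \<open>The componentwise inverses form a natural transformation in the opposite direction. This
  allows the comparison in the uniqueness proof to be built in the more convenient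
  direction.\<close>

lemma naturally_isomorphic_sym:
  assumes "is_category C" "is_category D" "is_functor C D F" "is_functor C D G"
    and "naturally_isomorphic C D F G"
  shows "naturally_isomorphic C D G F"
proof -
  interpret C: categ C by (rule categ.intro) fact
  interpret D: categ D by (rule categ.intro) fact
  obtain \<tau> where \<tau>: "\<And>A. A \<in> Ob C \<Longrightarrow> \<tau> A \<in> Hom D (on_ob F A) (on_ob G A)"
      "\<And>A. A \<in> Ob C \<Longrightarrow> is_iso D (\<tau> A)"
    and nat: "\<And>f. f \<in> Ar C \<Longrightarrow> Comp D (on_ar G f) (\<tau> (Dom C f)) = Comp D (\<tau> (Cod C f)) (on_ar F f)"
    using assms(5) unfolding naturally_isomorphic_def by blast
  have "\<exists>s. s \<in> Hom D (on_ob G A) (on_ob F A) \<and> is_iso D s \<and>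
      Comp D s (\<tau> A) = Ident D (on_ob F A) \<and> Comp D (\<tau> A) s = Ident D (on_ob G A)" if "A \<in> Ob C" for A
    using D.iso_inverse[OF \<tau>(2,1)[OF that]] by metis
  then obtain s where s: "\<And>A. A \<in> Ob C \<Longrightarrow> s A \<in> Hom D (on_ob G A) (on_ob F A) \<and> is_iso D (s A) \<and>
      Comp D (s A) (\<tau> A) = Ident D (on_ob F A) \<and> Comp D (\<tau> A) (s A) = Ident D (on_ob G A)"
    by metis
  have "Comp D (on_ar F f) (s (Dom C f)) = Comp D (s (Cod C f)) (on_ar G f)" if f: "f \<in> Ar C" for f
  proof -
    let ?A = "Dom C f" and ?B = "Cod C f"
    have AB: "?A \<in> Ob C" "?B \<in> Ob C" "f \<in> Hom C ?A ?B" using C.Hom_D[OF C.Ar_Hom[OF f]] C.Ar_Hom[OF f] by simp_all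
    note Ff = functor_Hom[OF assms(3) AB(3)] and Gf = functor_Hom[OF assms(4) AB(3)]
    have sA: "s ?A \<in> Hom D (on_ob G ?A) (on_ob F ?A)" and sB: "s ?B \<in> Hom D (on_ob G ?B) (on_ob F ?B)"
      using s AB by auto
    have "Comp D (on_ar F f) (s ?A) = Comp D (Comp D (s ?B) (\<tau> ?B)) (Comp D (on_ar F f) (s ?A))"
      using D.ident_comp[OF D.comp_Hom[OF Ff sA]] s AB by simp
    also have "\<dots> = Comp D (s ?B) (Comp D (Comp D (\<tau> ?B) (on_ar F f)) (s ?A))"
      using D.assoc[OF sB \<tau>(1)[OF AB(2)] D.comp_Hom[OF Ff sA]] D.assoc[OF \<tau>(1)[OF AB(2)] Ff sA] by simp
    also have "\<dots> = Comp D (s ?B) (Comp D (Comp D (on_ar G f) (\<tau> ?A)) (s ?A))"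
      using nat[OF f] by simp
    also have "\<dots> = Comp D (s ?B) (Comp D (on_ar G f) (Comp D (\<tau> ?A) (s ?A)))"
      using D.assoc[OF Gf \<tau>(1)[OF AB(1)] sA] by simp
    also have "\<dots> = Comp D (s ?B) (on_ar G f)" using s AB D.comp_ident[OF Gf] by simp
    finally show ?thesis .
  qed
  then show ?thesis using s unfolding naturally_isomorphic_def by (intro exI[of _ s]) blast
qed

section \<open>Objects on whose outgoing morphisms a functor is fully faithful\<close>

text \<open>Equivalently, the identity of \<open>on_ob P Y\<close> is a universal arrow from
  \<open>on_ob P Y\<close> to \<open>P\<close>: a left adjoint of \<open>P\<close>, as far as it
  exists, can take the value \<open>Y\<close> there with the identity as unit.\<close>

definition coreflective_ob ::
  "('o1, 'm1) cat \<Rightarrow> ('o2, 'm2) cat \<Rightarrow> ('o1, 'm1, 'o2, 'm2) functor_data \<Rightarrow> 'o1 \<Rightarrow> bool" where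
  "coreflective_ob A B P Y \<longleftrightarrow> Y \<in> Ob A \<and>
     (\<forall>W\<in>Ob A. bij_betw (on_ar P) (Hom A Y W) (Hom B (on_ob P Y) (on_ob P W)))"

lemma coreflective_ob_lift:
  assumes "coreflective_ob A B P Y" "W \<in> Ob A" "u \<in> Hom B (on_ob P Y) (on_ob P W)"
  obtains g where "g \<in> Hom A Y W" "on_ar P g = u"
proof -
  have "u \<in> on_ar P ` Hom A Y W" using assms by (simp add: coreflective_ob_def bij_betw_def)
  then show thesis using that by blast
qed

lemma coreflective_ob_unique:
  assumes "coreflective_ob A B P Y" "g \<in> Hom A Y W" "h \<in> Hom A Y W" "W \<in> Ob A" "on_ar P g = on_ar P h"
  shows "g = h"
  using assms unfolding coreflective_ob_def bij_betw_def inj_on_def by blast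

text \<open>Between such objects \<open>P\<close> is full and faithful: fullness lifts the inverse
  of \<open>on_ar P g\<close>, and faithfulness shows that the lift is inverse to
  \<open>g\<close>.\<close>

lemma coreflective_ob_iso:
  assumes "is_category A" "is_category B" "is_functor A B P"
    and Y: "coreflective_ob A B P Y" and Z: "coreflective_ob A B P Z"
    and g: "g \<in> Hom A Y Z" and iso: "is_iso B (on_ar P g)"
  shows "is_iso A g"
proof -
  interpret A: categ A by (rule categ.intro) fact
  interpret B: categ B by (rule categ.intro) fact
  have YZ: "Y \<in> Ob A" "Z \<in> Ob A" using A.Hom_D[OF g] by auto
  note P = assms(3)
  obtain v where v: "v \<in> Hom B (on_ob P Z) (on_ob P Y)"
    "Comp B v (on_ar P g) = Ident B (on_ob P Y)" "Comp B (on_ar P g) v = Ident B (on_ob P Z)"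
    using B.iso_inverse[OF iso functor_Hom[OF P g]] by metis
  obtain h where h: "h \<in> Hom A Z Y" "on_ar P h = v" using coreflective_ob_lift[OF Z YZ(1) v(1)] .
  have "Comp A h g = Ident A Y"
    by (rule coreflective_ob_unique[OF Y A.comp_Hom[OF h(1) g] A.ident_Hom[OF YZ(1)] YZ(1)])
      (simp add: functor_comp_ar[OF P h(1) g] h(2) v(2) functor_ident[OF P] YZ)
  moreover have "Comp A g h = Ident A Z"
    by (rule coreflective_ob_unique[OF Z A.comp_Hom[OF g h(1)] A.ident_Hom[OF YZ(2)] YZ(2)])
      (simp add: functor_comp_ar[OF P g h(1)] h(2) v(3) functor_ident[OF P] YZ)
  ultimately show ?thesis using A.isoI g h(1) by blast
qed

text \<open>The hypothesis \<open>surj\<close> amounts to a left adjoint of \<open>P\<close> with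
  invertible unit. The hypothesis \<open>core\<close> makes \<open>F\<close> invert the counit; its
  \<open>Y\<close> and \<open>j\<close> may be chosen freely, since coreflective objects with
  isomorphic images under \<open>P\<close> are isomorphic.\<close>

theorem factorisation_through_coreflection:
  fixes A :: "('o1, 'm1) cat" and B :: "('o2, 'm2) cat" and C :: "('o3, 'm3) cat"
  assumes A: "is_category A" and B: "is_category B" and C: "is_category C"
    and P: "is_functor A B P" and F: "is_functor A C F"
    and surj: "\<And>M. M \<in> Ob B \<Longrightarrow> \<exists>Y e. coreflective_ob A B P Y \<and> e \<in> Hom B M (on_ob P Y) \<and> is_iso B e"
    and core: "\<And>W. W \<in> Ob A \<Longrightarrow> \<exists>Y j. coreflective_ob A B P Y \<and> j \<in> Hom A Y W \<and>
      is_iso B (on_ar P j) \<and> is_iso C (on_ar F j)"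
  shows "\<exists>F'. is_functor B C F' \<and> naturally_isomorphic A C (functor_comp F' P) F \<and>
    (\<forall>F''. is_functor B C F'' \<and> naturally_isomorphic A C (functor_comp F'' P) F \<longrightarrow>
      naturally_isomorphic B C F' F'')"
proof -
  interpret A: categ A by (rule categ.intro) fact
  interpret B: categ B by (rule categ.intro) fact
  interpret C: categ C by (rule categ.intro) fact
  note Pob = functor_ob[OF P] and Pid = functor_ident[OF P]
  obtain \<Phi> e where \<Phi>: "\<And>M. M \<in> Ob B \<Longrightarrow> coreflective_ob A B P (\<Phi> M)"
    and e: "\<And>M. M \<in> Ob B \<Longrightarrow> e M \<in> Hom B M (on_ob P (\<Phi> M))"
    and e_iso: "\<And>M. M \<in> Ob B \<Longrightarrow> is_iso B (e M)"
    using surj by metis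
  have \<Phi>_ob: "\<Phi> M \<in> Ob A" if "M \<in> Ob B" for M using \<Phi>[OF that] by (simp add: coreflective_ob_def)
  have "\<exists>d. d \<in> Hom B (on_ob P (\<Phi> M)) M \<and> is_iso B d \<and> Comp B d (e M) = Ident B M \<and>
      Comp B (e M) d = Ident B (on_ob P (\<Phi> M))" if "M \<in> Ob B" for M
    using B.iso_inverse[OF e_iso e, OF that that] by metis
  then obtain d where d: "\<And>M. M \<in> Ob B \<Longrightarrow> d M \<in> Hom B (on_ob P (\<Phi> M)) M"
    and d_iso: "\<And>M. M \<in> Ob B \<Longrightarrow> is_iso B (d M)"
    and de: "\<And>M. M \<in> Ob B \<Longrightarrow> Comp B (d M) (e M) = Ident B M"
    and ed: "\<And>M. M \<in> Ob B \<Longrightarrow> Comp B (e M) (d M) = Ident B (on_ob P (\<Phi> M))"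
    by metis
  \<comment> \<open>As \<open>e M\<close> is invertible, the universal property of
    \<open>\<Phi> M\<close> transfers from \<open>on_ob P (\<Phi> M)\<close> to \<open>M\<close>: by
    \<open>unique\<close> and \<open>lift\<close>, \<open>e M\<close> is a universal arrow from
    \<open>M\<close> to \<open>P\<close>.\<close>
  have unique: "g = h"
    if M: "M \<in> Ob B" and g: "g \<in> Hom A (\<Phi> M) W" and h: "h \<in> Hom A (\<Phi> M) W"
      and eq: "Comp B (on_ar P g) (e M) = Comp B (on_ar P h) (e M)" for M W g h
  proof -
    have "on_ar P k = Comp B (Comp B (on_ar P k) (e M)) (d M)" if "k \<in> Hom A (\<Phi> M) W" for k
      using B.assoc[OF functor_Hom[OF P that] e[OF M] d[OF M]] ed[OF M]
        B.comp_ident[OF functor_Hom[OF P that]] by simp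
    from this[OF g] this[OF h] have "on_ar P g = on_ar P h" using eq by simp
    then show ?thesis
      using coreflective_ob_unique[OF \<Phi>[OF M] g h] A.Hom_D[OF g] by blast
  qed
  have lift: "\<exists>g. g \<in> Hom A (\<Phi> M) W \<and> Comp B (on_ar P g) (e M) = u"
    if M: "M \<in> Ob B" and W: "W \<in> Ob A" and u: "u \<in> Hom B M (on_ob P W)" for M W u
  proof -
    obtain g where g: "g \<in> Hom A (\<Phi> M) W" "on_ar P g = Comp B u (d M)"
      using coreflective_ob_lift[OF \<Phi>[OF M] W B.comp_Hom[OF u d[OF M]]] .
    have "Comp B (on_ar P g) (e M) = u"
      unfolding g(2) using B.assoc[OF u d[OF M] e[OF M]] de[OF M] B.comp_ident[OF u] by simp
    then show ?thesis using g(1) by blast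
  qed
  \<comment> \<open>The left adjoint on arrows: \<open>\<phi> f\<close> is the only morphism that
    makes \<open>e\<close> natural at \<open>f\<close>. This uniqueness gives functoriality.\<close>
  have "\<exists>g. g \<in> Hom A (\<Phi> (Dom B f)) (\<Phi> (Cod B f)) \<and>
      Comp B (on_ar P g) (e (Dom B f)) = Comp B (e (Cod B f)) f" if "f \<in> Ar B" for f
  proof -
    note f = B.Ar_Hom[OF that]
    have ob: "Dom B f \<in> Ob B" "Cod B f \<in> Ob B" using B.Hom_D[OF f] by auto
    show ?thesis using lift[OF ob(1) \<Phi>_ob[OF ob(2)] B.comp_Hom[OF e[OF ob(2)] f]] .
  qed
  then obtain \<phi> where \<phi>': "\<And>f. f \<in> Ar B \<Longrightarrow> \<phi> f \<in> Hom A (\<Phi> (Dom B f)) (\<Phi> (Cod B f)) \<and>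
      Comp B (on_ar P (\<phi> f)) (e (Dom B f)) = Comp B (e (Cod B f)) f"
    by metis
  have \<phi>: "\<phi> f \<in> Hom A (\<Phi> M) (\<Phi> N)" and \<phi>_nat: "Comp B (on_ar P (\<phi> f)) (e M) = Comp B (e N) f"
    if "f \<in> Hom B M N" for f M N
    using \<phi>'[of f] B.Hom_D[OF that] by auto
  have \<phi>_id: "\<phi> (Ident B M) = Ident A (\<Phi> M)" if M: "M \<in> Ob B" for M
  proof (rule unique[OF M \<phi>[OF B.ident_Hom[OF M]] A.ident_Hom[OF \<Phi>_ob[OF M]]])
    show "Comp B (on_ar P (\<phi> (Ident B M))) (e M) = Comp B (on_ar P (Ident A (\<Phi> M))) (e M)"
      using \<phi>_nat[OF B.ident_Hom[OF M]] B.comp_ident[OF e[OF M]] B.ident_comp[OF e[OF M]]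
        Pid[OF \<Phi>_ob[OF M]] by simp
  qed
  have \<phi>_comp: "\<phi> (Comp B g f) = Comp A (\<phi> g) (\<phi> f)"
    if f: "f \<in> Hom B M N" and g: "g \<in> Hom B N K" for f g M N K
  proof -
    have ob: "M \<in> Ob B" "N \<in> Ob B" "K \<in> Ob B" using B.Hom_D[OF f] B.Hom_D[OF g] by auto
    note Pf = functor_Hom[OF P \<phi>[OF f]] and Pg = functor_Hom[OF P \<phi>[OF g]]
    have "Comp B (on_ar P (Comp A (\<phi> g) (\<phi> f))) (e M)
        = Comp B (on_ar P (\<phi> g)) (Comp B (on_ar P (\<phi> f)) (e M))"
      using functor_comp_ar[OF P \<phi>[OF g] \<phi>[OF f]] B.assoc[OF Pg Pf e[OF ob(1)]] by simp
    also have "\<dots> = Comp B (Comp B (e K) g) f"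
      using \<phi>_nat[OF f] \<phi>_nat[OF g] B.assoc[OF Pg e[OF ob(2)] f] by simp
    also have "\<dots> = Comp B (e K) (Comp B g f)" using B.assoc[OF e[OF ob(3)] g f] by simp
    also have "\<dots> = Comp B (on_ar P (\<phi> (Comp B g f))) (e M)"
      using \<phi>_nat[OF B.comp_Hom[OF g f]] by simp
    finally show ?thesis
      using unique[OF ob(1) \<phi>[OF B.comp_Hom[OF g f]] A.comp_Hom[OF \<phi>[OF g] \<phi>[OF f]]] by simp
  qed
  define F' where "F' = \<lparr>on_ob = \<lambda>M. on_ob F (\<Phi> M), on_ar = \<lambda>f. on_ar F (\<phi> f)\<rparr>"
  have F': "is_functor B C F'"
    unfolding is_functor_def
  proof (intro conjI ballI impI)
    fix M assume M: "M \<in> Ob B"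
    show "on_ob F' M \<in> Ob C" "on_ar F' (Ident B M) = Ident C (on_ob F' M)"
      using functor_ob[OF F \<Phi>_ob[OF M]] functor_ident[OF F \<Phi>_ob[OF M]] \<phi>_id[OF M] by (simp_all add: F'_def)
  next
    fix f assume "f \<in> Ar B"
    then have f: "f \<in> Hom B (Dom B f) (Cod B f)" by (rule B.Ar_Hom)
    show "on_ar F' f \<in> Hom C (on_ob F' (Dom B f)) (on_ob F' (Cod B f))"
      using functor_Hom[OF F \<phi>[OF f]] by (simp add: F'_def)
    fix g assume "g \<in> Ar B" "Dom B g = Cod B f"
    then have g: "g \<in> Hom B (Cod B f) (Cod B g)" using B.Ar_Hom by metis
    show "on_ar F' (Comp B g f) = Comp C (on_ar F' g) (on_ar F' f)"
      using functor_comp_ar[OF F \<phi>[OF g] \<phi>[OF f]] \<phi>_comp[OF f g] by (simp add: F'_def)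
  qed
  \<comment> \<open>The counit \<open>\<iota> W\<close> arises as the morphism that corresponds to
    the identity of \<open>on_ob P W\<close>.\<close>
  have "\<exists>i. i \<in> Hom A (\<Phi> (on_ob P W)) W \<and>
      Comp B (on_ar P i) (e (on_ob P W)) = Ident B (on_ob P W)" if "W \<in> Ob A" for W
    using lift[OF Pob[OF that] that B.ident_Hom[OF Pob[OF that]]] .
  then obtain \<iota> where \<iota>: "\<And>W. W \<in> Ob A \<Longrightarrow> \<iota> W \<in> Hom A (\<Phi> (on_ob P W)) W"
    and \<iota>_e: "\<And>W. W \<in> Ob A \<Longrightarrow> Comp B (on_ar P (\<iota> W)) (e (on_ob P W)) = Ident B (on_ob P W)"
    by metis
  \<comment> \<open>The object \<open>Y\<close> from \<open>core\<close> may differ from the chosen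
    \<open>\<Phi> (on_ob P W)\<close>. The comparison \<open>g\<close> between them is invertible
    because its image under \<open>P\<close> is, and \<open>\<iota> W\<close> is \<open>j\<close>
    after \<open>g\<close>.\<close>
  have F\<iota>: "is_iso C (on_ar F (\<iota> W))" if W: "W \<in> Ob A" for W
  proof -
    let ?M = "on_ob P W"
    obtain Y j where Y: "coreflective_ob A B P Y" and j: "j \<in> Hom A Y W"
      and Pj: "is_iso B (on_ar P j)" and Fj: "is_iso C (on_ar F j)"
      using core[OF W] by metis
    obtain v where v: "v \<in> Hom B ?M (on_ob P Y)" "is_iso B v" "Comp B (on_ar P j) v = Ident B ?M"
      using B.iso_inverse[OF Pj functor_Hom[OF P j]] by metis
    have M: "?M \<in> Ob B" using Pob[OF W] .
    have Yob: "Y \<in> Ob A" using A.Hom_D[OF j] by blast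
    have vd: "Comp B v (d ?M) \<in> Hom B (on_ob P (\<Phi> ?M)) (on_ob P Y)" using B.comp_Hom[OF v(1) d[OF M]] .
    obtain g where g: "g \<in> Hom A (\<Phi> ?M) Y" "on_ar P g = Comp B v (d ?M)"
      using coreflective_ob_lift[OF \<Phi>[OF M] Yob vd] .
    have "is_iso B (on_ar P g)" unfolding g(2) using B.comp_iso[OF v(2,1) d_iso[OF M] d[OF M]] .
    then have "is_iso A g" by (rule coreflective_ob_iso[OF A B P \<Phi>[OF M] Y g(1)])
    then have Fg: "is_iso C (on_ar F g)" by (rule functor_iso[OF A C F])
    have "Comp B (on_ar P (Comp A j g)) (e ?M) = Comp B (Comp B (on_ar P j) (on_ar P g)) (e ?M)"
      using functor_comp_ar[OF P j g(1)] by simp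
    also have "\<dots> = Comp B (on_ar P j) (Comp B (Comp B v (d ?M)) (e ?M))"
      using B.assoc[OF functor_Hom[OF P j] vd e[OF M]] g(2) by simp
    also have "\<dots> = Ident B ?M"
      using B.assoc[OF v(1) d[OF M] e[OF M]] de[OF M] B.comp_ident[OF v(1)] v(3) by simp
    finally have "Comp A j g = \<iota> W"
      using unique[OF M A.comp_Hom[OF j g(1)] \<iota>[OF W]] \<iota>_e[OF W] by simp
    then show ?thesis
      using C.comp_iso[OF Fj functor_Hom[OF F j] Fg functor_Hom[OF F g(1)]]
        functor_comp_ar[OF F j g(1)] by simp
  qed
  \<comment> \<open>Both composites correspond to \<open>on_ar P f\<close> under the universal
    property of \<open>e\<close>.\<close>
  have \<iota>_nat: "Comp A f (\<iota> W) = Comp A (\<iota> Y) (\<phi> (on_ar P f))" if f: "f \<in> Hom A W Y" for f W Y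
  proof -
    have ob: "W \<in> Ob A" "Y \<in> Ob A" using A.Hom_D[OF f] by auto
    note Pf = functor_Hom[OF P f]
    note \<phi>f = \<phi>[OF Pf]
    note M = Pob[OF ob(1)] and N = Pob[OF ob(2)]
    have "Comp B (on_ar P (Comp A f (\<iota> W))) (e (on_ob P W)) = on_ar P f"
      using functor_comp_ar[OF P f \<iota>[OF ob(1)]] B.assoc[OF Pf functor_Hom[OF P \<iota>[OF ob(1)]] e[OF M]]
        \<iota>_e[OF ob(1)] B.comp_ident[OF Pf] by simp
    moreover have "Comp B (on_ar P (Comp A (\<iota> Y) (\<phi> (on_ar P f)))) (e (on_ob P W))
        = Comp B (on_ar P (\<iota> Y)) (Comp B (e (on_ob P Y)) (on_ar P f))"
      using functor_comp_ar[OF P \<iota>[OF ob(2)] \<phi>f] \<phi>_nat[OF Pf]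
        B.assoc[OF functor_Hom[OF P \<iota>[OF ob(2)]] functor_Hom[OF P \<phi>f] e[OF M]] by simp
    moreover have "\<dots> = on_ar P f"
      using B.assoc[OF functor_Hom[OF P \<iota>[OF ob(2)]] e[OF N] Pf] \<iota>_e[OF ob(2)] B.ident_comp[OF Pf] by simp
    ultimately show ?thesis
      using unique[OF M A.comp_Hom[OF f \<iota>[OF ob(1)]] A.comp_Hom[OF \<iota>[OF ob(2)] \<phi>f]] by simp
  qed
  have "naturally_isomorphic A C (functor_comp F' P) F"
    unfolding naturally_isomorphic_def
  proof (intro exI[of _ "\<lambda>W. on_ar F (\<iota> W)"] conjI ballI)
    fix W assume W: "W \<in> Ob A"
    show "on_ar F (\<iota> W) \<in> Hom C (on_ob (functor_comp F' P) W) (on_ob F W)"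
      using functor_Hom[OF F \<iota>[OF W]] by (simp add: F'_def functor_comp_def)
    show "is_iso C (on_ar F (\<iota> W))" using F\<iota>[OF W] .
  next
    fix f assume "f \<in> Ar A"
    then have f: "f \<in> Hom A (Dom A f) (Cod A f)" by (rule A.Ar_Hom)
    have ob: "Dom A f \<in> Ob A" "Cod A f \<in> Ob A" using A.Hom_D[OF f] by auto
    show "Comp C (on_ar F f) (on_ar F (\<iota> (Dom A f)))
        = Comp C (on_ar F (\<iota> (Cod A f))) (on_ar (functor_comp F' P) f)"
      using \<iota>_nat[OF f] functor_comp_ar[OF F f \<iota>[OF ob(1)]]
        functor_comp_ar[OF F \<iota>[OF ob(2)] \<phi>[OF functor_Hom[OF P f]]]
      by (simp add: F'_def functor_comp_def)
  qed
  moreover have "naturally_isomorphic B C F' F''"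
    if F'': "is_functor B C F''" and iso: "naturally_isomorphic A C (functor_comp F'' P) F" for F''
  proof -
    obtain \<sigma> where \<sigma>: "\<And>W. W \<in> Ob A \<Longrightarrow> \<sigma> W \<in> Hom C (on_ob F'' (on_ob P W)) (on_ob F W)"
        "\<And>W. W \<in> Ob A \<Longrightarrow> is_iso C (\<sigma> W)"
      and \<sigma>_nat': "\<And>f. f \<in> Ar A \<Longrightarrow> Comp C (on_ar F f) (\<sigma> (Dom A f)) = Comp C (\<sigma> (Cod A f)) (on_ar F'' (on_ar P f))"
      using iso unfolding naturally_isomorphic_def functor_comp_def by auto
    have \<sigma>_nat: "Comp C (on_ar F f) (\<sigma> W) = Comp C (\<sigma> Y) (on_ar F'' (on_ar P f))" if "f \<in> Hom A W Y" for f W Y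
      using \<sigma>_nat'[of f] A.Hom_D[OF that] by auto
    \<comment> \<open>The component at \<open>M\<close> runs from \<open>F'' M\<close> to
      \<open>F'' (P (\<Phi> M))\<close> by the image of the unit, and on to
      \<open>F (\<Phi> M)\<close>, which is \<open>F' M\<close>, by \<open>\<sigma>\<close>.\<close>
    have "naturally_isomorphic B C F'' F'"
      unfolding naturally_isomorphic_def
    proof (intro exI[of _ "\<lambda>M. Comp C (\<sigma> (\<Phi> M)) (on_ar F'' (e M))"] conjI ballI)
      fix M assume M: "M \<in> Ob B"
      note s = \<sigma>[OF \<Phi>_ob[OF M]] and Fe = functor_Hom[OF F'' e[OF M]]
      show "Comp C (\<sigma> (\<Phi> M)) (on_ar F'' (e M)) \<in> Hom C (on_ob F'' M) (on_ob F' M)"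
        using C.comp_Hom[OF s(1) Fe] by (simp add: F'_def)
      show "is_iso C (Comp C (\<sigma> (\<Phi> M)) (on_ar F'' (e M)))"
        using C.comp_iso[OF s(2,1) functor_iso[OF B C F'' e_iso[OF M]] Fe] .
    next
      fix f assume "f \<in> Ar B"
      then have f: "f \<in> Hom B (Dom B f) (Cod B f)" by (rule B.Ar_Hom)
      let ?M = "Dom B f" and ?N = "Cod B f"
      have M: "?M \<in> Ob B" and N: "?N \<in> Ob B" using B.Hom_D[OF f] by auto
      note s = \<sigma>(1)[OF \<Phi>_ob[OF M]] and t = \<sigma>(1)[OF \<Phi>_ob[OF N]]
        and Fe = functor_Hom[OF F'' e[OF M]] and Fd = functor_Hom[OF F'' e[OF N]]
        and Ff = functor_Hom[OF F'' f] and \<phi>f = \<phi>[OF f]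
      note P\<phi> = functor_Hom[OF P \<phi>f]
      have "Comp C (on_ar F' f) (Comp C (\<sigma> (\<Phi> ?M)) (on_ar F'' (e ?M)))
          = Comp C (Comp C (\<sigma> (\<Phi> ?N)) (on_ar F'' (on_ar P (\<phi> f)))) (on_ar F'' (e ?M))"
        using C.assoc[OF functor_Hom[OF F \<phi>f] s Fe] \<sigma>_nat[OF \<phi>f] by (simp add: F'_def)
      also have "\<dots> = Comp C (\<sigma> (\<Phi> ?N)) (on_ar F'' (Comp B (on_ar P (\<phi> f)) (e ?M)))"
        using C.assoc[OF t functor_Hom[OF F'' P\<phi>] Fe] functor_comp_ar[OF F'' P\<phi> e[OF M]] by simp
      also have "\<dots> = Comp C (Comp C (\<sigma> (\<Phi> ?N)) (on_ar F'' (e ?N))) (on_ar F'' f)"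
        using \<phi>_nat[OF f] functor_comp_ar[OF F'' e[OF N] f] C.assoc[OF t Fd Ff] by simp
      finally show "Comp C (on_ar F' f) (Comp C (\<sigma> (\<Phi> ?M)) (on_ar F'' (e ?M)))
          = Comp C (Comp C (\<sigma> (\<Phi> ?N)) (on_ar F'' (e ?N))) (on_ar F'' f)" .
    qed
    then show ?thesis by (rule naturally_isomorphic_sym[OF B C F'' F'])
  qed
  ultimately show ?thesis using F' by blast
qed

section \<open>Groups of fractions\<close>

lemma (in group) inv_cancel_left:
  "a \<in> carrier G \<Longrightarrow> x \<in> carrier G \<Longrightarrow> inv a \<otimes> (a \<otimes> x) = x"
  "a \<in> carrier G \<Longrightarrow> x \<in> carrier G \<Longrightarrow> a \<otimes> (inv a \<otimes> x) = x"
  by (simp_all flip: m_assoc)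

text \<open>If \<open>P\<close> is a submonoid closed under conjugation by its own elements and
  their inverses, this is the subgroup generated by \<open>P\<close>.\<close>

definition fractions :: "('a, 'b) monoid_scheme \<Rightarrow> 'a set \<Rightarrow> 'a set" where
  "fractions G P = {a \<otimes>\<^bsub>G\<^esub> inv\<^bsub>G\<^esub> b | a b. a \<in> P \<and> b \<in> P}"

text \<open>Invariance is required only under elements of \<open>P\<close>, because the exchange
  condition in \<open>MonGe0\<close> gives no more for a monoid embedded in a group. Both directions
  are stated since inverses of elements of \<open>P\<close> may lie outside
  \<open>P\<close>.\<close>

locale invariant_submonoid = group G + submonoid P G for P and G (structure) +
  assumes conj_left: "a \<in> P \<Longrightarrow> b \<in> P \<Longrightarrow> a \<otimes> b \<otimes> inv a \<in> P"
    and conj_right: "a \<in> P \<Longrightarrow> b \<in> P \<Longrightarrow> inv a \<otimes> b \<otimes> a \<in> P"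
begin

lemma P_mult: "a \<in> P \<Longrightarrow> b \<in> P \<Longrightarrow> a \<otimes> b \<in> P"
  by (rule submonoid.m_closed[OF is_submonoid])

lemma P_one: "\<one> \<in> P"
  by (rule submonoid.one_closed[OF is_submonoid])

lemma fractions_cases:
  assumes "x \<in> fractions G P"
  obtains a b where "a \<in> P" "b \<in> P" "x = a \<otimes> inv b"
  using assms by (auto simp: fractions_def)

lemma fractionsI: "a \<in> P \<Longrightarrow> b \<in> P \<Longrightarrow> a \<otimes> inv b \<in> fractions G P"
  by (auto simp: fractions_def)

lemma P_fractions: "P \<subseteq> fractions G P"
  using fractionsI[OF _ P_one] by auto

text \<open>Moving \<open>inv b\<close> to the right past \<open>c\<close> replaces \<open>c\<close>
  by its conjugate \<open>inv b \<otimes> c \<otimes> b\<close>, which lies in \<open>P\<close>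
  again. The two inverses then merge into \<open>inv (d \<otimes> b)\<close>.\<close>

lemma fractions_mult:
  assumes "a \<in> P" "b \<in> P" "c \<in> P" "d \<in> P"
  shows "(a \<otimes> inv b) \<otimes> (c \<otimes> inv d) = (a \<otimes> (inv b \<otimes> c \<otimes> b)) \<otimes> inv (d \<otimes> b)"
  using assms by (simp add: m_assoc inv_mult_group inv_cancel_left)

lemma fractions_subgroup: "subgroup (fractions G P) G"
proof (rule subgroupI)
  show "fractions G P \<subseteq> carrier G" by (auto simp: fractions_def)
  show "fractions G P \<noteq> {}" using P_fractions P_one by blast
next
  fix x assume "x \<in> fractions G P"
  then obtain a b where ab: "a \<in> P" "b \<in> P" "x = a \<otimes> inv b" by (rule fractions_cases)
  have "inv x = b \<otimes> inv a" using ab by (simp add: inv_mult_group)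
  then show "inv x \<in> fractions G P" using fractionsI ab by simp
  fix y assume "y \<in> fractions G P"
  then obtain c d where cd: "c \<in> P" "d \<in> P" "y = c \<otimes> inv d" by (rule fractions_cases)
  show "x \<otimes> y \<in> fractions G P"
    unfolding ab(3) cd(3) fractions_mult[OF ab(1,2) cd(1,2)]
    using ab cd by (intro fractionsI P_mult conj_right)
qed

lemma fractions_group: "group (G\<lparr>carrier := fractions G P\<rparr>)"
  by (rule subgroup.subgroup_is_group[OF fractions_subgroup is_group])

lemma fractions_inv: "x \<in> fractions G P \<Longrightarrow> inv\<^bsub>G\<lparr>carrier := fractions G P\<rparr>\<^esub> x = inv x"
  using m_inv_consistent[OF fractions_subgroup] by simp

text \<open>This lets the criterion \<open>carrier G = fractions G P\<close> for coreflectivity be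
  applied to the group of fractions itself. Inverses in a subgroup are those of the ambient
  group.\<close>

lemma fractions_idem: "fractions (G\<lparr>carrier := fractions G P\<rparr>) P = fractions G P"
proof -
  define K where "K = G\<lparr>carrier := fractions G P\<rparr>"
  have eq: "a \<otimes>\<^bsub>K\<^esub> inv\<^bsub>K\<^esub> b = a \<otimes> inv b" if "b \<in> P" for a b
    using fractions_inv[OF subsetD[OF P_fractions that]] by (simp add: K_def)
  have "fractions K P = fractions G P"
    unfolding fractions_def by (intro Collect_cong ex_cong1) (use eq in auto)
  then show ?thesis by (simp add: K_def)
qed

text \<open>Conjugation by \<open>a \<otimes> inv b\<close> is conjugation by \<open>inv b\<close>
  followed by conjugation by \<open>a\<close>.\<close>

lemma fractions_cone:
  assumes "x \<in> fractions G P" "p \<in> P"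
  shows "x \<otimes> p \<otimes> inv x \<in> P"
proof -
  obtain a b where ab: "a \<in> P" "b \<in> P" "x = a \<otimes> inv b" using assms(1) by (rule fractions_cases)
  have "x \<otimes> p \<otimes> inv x = a \<otimes> (inv b \<otimes> p \<otimes> b) \<otimes> inv a"
    using ab assms(2) by (simp add: inv_mult_group m_assoc)
  then show ?thesis using conj_left[OF ab(1) conj_right[OF ab(2) assms(2)]] by simp
qed

section \<open>Extending homomorphisms from a cone to its fractions\<close>

text \<open>As \<open>f\<close> respects products only within \<open>P\<close>, the equality of
  fractions is first turned into equations in \<open>P\<close>. With
  \<open>e = inv b \<otimes> d \<otimes> b\<close> these are
  \<open>d \<otimes> b = b \<otimes> e\<close> and \<open>a \<otimes> e = c \<otimes> b\<close>;
  applying \<open>f\<close> and cancelling in \<open>H\<close> gives the claim.\<close>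

lemma fractions_eq_hom:
  assumes "group H" and f: "f \<in> hom (G\<lparr>carrier := P\<rparr>) H"
    and abcd: "a \<in> P" "b \<in> P" "c \<in> P" "d \<in> P" and eq: "a \<otimes> inv b = c \<otimes> inv d"
  shows "f a \<otimes>\<^bsub>H\<^esub> inv\<^bsub>H\<^esub> f b = f c \<otimes>\<^bsub>H\<^esub> inv\<^bsub>H\<^esub> f d"
proof -
  interpret H: group H by fact
  have fc: "f x \<in> carrier H" if "x \<in> P" for x using f that by (auto simp: hom_def)
  have fm: "f (x \<otimes> y) = f x \<otimes>\<^bsub>H\<^esub> f y" if "x \<in> P" "y \<in> P" for x y using f that by (auto simp: hom_def)
  define e where "e = inv b \<otimes> d \<otimes> b"
  have e: "e \<in> P" unfolding e_def using conj_right abcd by blast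
  have "d \<otimes> b = b \<otimes> e" using abcd by (simp add: e_def inv_cancel_left m_assoc)
  then have 1: "f d \<otimes>\<^bsub>H\<^esub> f b = f b \<otimes>\<^bsub>H\<^esub> f e" using fm abcd e by metis
  have "a \<otimes> e = (a \<otimes> inv b) \<otimes> d \<otimes> b" using abcd by (simp add: e_def m_assoc)
  also have "\<dots> = c \<otimes> b" using abcd by (simp add: eq m_assoc)
  finally have 2: "f a \<otimes>\<^bsub>H\<^esub> f e = f c \<otimes>\<^bsub>H\<^esub> f b" using fm abcd e by metis
  have "f e = inv\<^bsub>H\<^esub> f b \<otimes>\<^bsub>H\<^esub> (f d \<otimes>\<^bsub>H\<^esub> f b)"
    using 1 fc abcd e by (simp add: H.inv_cancel_left)
  with 2 have "f a \<otimes>\<^bsub>H\<^esub> inv\<^bsub>H\<^esub> f b \<otimes>\<^bsub>H\<^esub> f d \<otimes>\<^bsub>H\<^esub> f b = f c \<otimes>\<^bsub>H\<^esub> f b"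
    using fc abcd by (simp add: H.m_assoc)
  then have "f a \<otimes>\<^bsub>H\<^esub> inv\<^bsub>H\<^esub> f b \<otimes>\<^bsub>H\<^esub> f d = f c"
    using fc abcd by simp
  then show ?thesis using fc abcd by (metis H.inv_closed H.inv_solve_right H.m_closed)
qed

text \<open>The extension sends \<open>a \<otimes> inv b\<close> to the corresponding fraction of
  images. It is well defined by \<open>fractions_eq_hom\<close> and multiplicative by
  \<open>fractions_mult\<close>.\<close>

lemma hom_fractions_extend:
  assumes "group H" and f: "f \<in> hom (G\<lparr>carrier := P\<rparr>) H"
  obtains h where "h \<in> hom (G\<lparr>carrier := fractions G P\<rparr>) H" "\<And>x. x \<in> P \<Longrightarrow> h x = f x"
proof -
  interpret H: group H by fact
  have fc: "f x \<in> carrier H" if "x \<in> P" for x using f that by (auto simp: hom_def)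
  have fm: "f (x \<otimes> y) = f x \<otimes>\<^bsub>H\<^esub> f y" if "x \<in> P" "y \<in> P" for x y using f that by (auto simp: hom_def)
  \<comment> \<open>Membership in \<open>hom\<close> does not include preservation of the unit, but
    \<open>f \<one>\<close> is an idempotent of a group.\<close>
  have f1: "f \<one> = \<one>\<^bsub>H\<^esub>"
    using fm[OF P_one P_one] fc[OF P_one] by simp
  define h where "h x = (SOME y. \<exists>a\<in>P. \<exists>b\<in>P. x = a \<otimes> inv b \<and> y = f a \<otimes>\<^bsub>H\<^esub> inv\<^bsub>H\<^esub> f b)" for x
  have h: "h (a \<otimes> inv b) = f a \<otimes>\<^bsub>H\<^esub> inv\<^bsub>H\<^esub> f b" if "a \<in> P" "b \<in> P" for a b
    unfolding h_def
  proof (rule some_equality)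
    show "\<exists>a'\<in>P. \<exists>b'\<in>P. a \<otimes> inv b = a' \<otimes> inv b' \<and> f a \<otimes>\<^bsub>H\<^esub> inv\<^bsub>H\<^esub> f b = f a' \<otimes>\<^bsub>H\<^esub> inv\<^bsub>H\<^esub> f b'"
      using that by blast
  next
    fix y assume "\<exists>a'\<in>P. \<exists>b'\<in>P. a \<otimes> inv b = a' \<otimes> inv b' \<and> y = f a' \<otimes>\<^bsub>H\<^esub> inv\<^bsub>H\<^esub> f b'"
    then show "y = f a \<otimes>\<^bsub>H\<^esub> inv\<^bsub>H\<^esub> f b"
      using fractions_eq_hom[OF assms that] by metis
  qed
  have "h \<in> hom (G\<lparr>carrier := fractions G P\<rparr>) H"
  proof (rule homI)
    fix x assume "x \<in> carrier (G\<lparr>carrier := fractions G P\<rparr>)"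
    then obtain a b where ab: "a \<in> P" "b \<in> P" "x = a \<otimes> inv b" using fractions_cases by auto
    show "h x \<in> carrier H" using ab h fc by simp
    fix y assume "y \<in> carrier (G\<lparr>carrier := fractions G P\<rparr>)"
    then obtain c d where cd: "c \<in> P" "d \<in> P" "y = c \<otimes> inv d" using fractions_cases by auto
    \<comment> \<open>The conjugate from \<open>fractions_mult\<close>. Its image under
      \<open>f\<close> is determined by the equation \<open>c \<otimes> b = b \<otimes> e\<close>,
      which holds inside \<open>P\<close>.\<close>
    define e where "e = inv b \<otimes> c \<otimes> b"
    have e: "e \<in> P" unfolding e_def using conj_right ab cd by blast
    have "c \<otimes> b = b \<otimes> e" using ab cd by (simp add: e_def inv_cancel_left m_assoc)
    then have "f c \<otimes>\<^bsub>H\<^esub> f b = f b \<otimes>\<^bsub>H\<^esub> f e" using fm ab cd e by metis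
    then have fe: "f e = inv\<^bsub>H\<^esub> f b \<otimes>\<^bsub>H\<^esub> (f c \<otimes>\<^bsub>H\<^esub> f b)"
      using fc ab cd e by (simp add: H.inv_cancel_left)
    have "x \<otimes> y = (a \<otimes> e) \<otimes> inv (d \<otimes> b)" using fractions_mult ab cd by (simp add: e_def)
    then have "h (x \<otimes> y) = f (a \<otimes> e) \<otimes>\<^bsub>H\<^esub> inv\<^bsub>H\<^esub> f (d \<otimes> b)"
      using h P_mult ab cd e by simp
    also have "\<dots> = h x \<otimes>\<^bsub>H\<^esub> h y"
      using h fm fc ab cd e by (simp add: fe H.m_assoc H.inv_mult_group H.inv_cancel_left)
    finally show "h (x \<otimes>\<^bsub>G\<lparr>carrier := fractions G P\<rparr>\<^esub> y) = h x \<otimes>\<^bsub>H\<^esub> h y" by simp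
  qed
  moreover have "h x = f x" if "x \<in> P" for x
    using h[OF that P_one] that fc f1 by simp
  ultimately show thesis using that by blast
qed

text \<open>A homomorphism between groups preserves inverses, so its value at
  \<open>a \<otimes> inv b\<close> is determined by those at \<open>a\<close> and
  \<open>b\<close>.\<close>

lemma hom_fractions_unique:
  assumes "group H" and g: "g \<in> hom (G\<lparr>carrier := fractions G P\<rparr>) H"
    and h: "h \<in> hom (G\<lparr>carrier := fractions G P\<rparr>) H"
    and eq: "\<And>x. x \<in> P \<Longrightarrow> g x = h x" and x: "x \<in> fractions G P"
  shows "g x = h x"
proof -
  let ?K = "G\<lparr>carrier := fractions G P\<rparr>"
  obtain a b where ab: "a \<in> P" "b \<in> P" "x = a \<otimes> inv b" using x by (rule fractions_cases)
  have K: "a \<in> fractions G P" "b \<in> fractions G P" using ab P_fractions by auto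
  have "k x = k a \<otimes>\<^bsub>H\<^esub> inv\<^bsub>H\<^esub> k b" if k: "k \<in> hom ?K H" for k
  proof -
    interpret k: group_hom ?K H k
      using fractions_group assms(1) k by (simp add: group_hom_def group_hom_axioms_def)
    have "k (a \<otimes>\<^bsub>?K\<^esub> inv\<^bsub>?K\<^esub> b) = k a \<otimes>\<^bsub>H\<^esub> inv\<^bsub>H\<^esub> k b"
      using K k.G.inv_closed[of b] by (subst k.hom_mult) (simp_all del: k.hom_mult)
    then show ?thesis using fractions_inv[OF K(2)] ab(3) by simp
  qed
  from this[OF g] this[OF h] show ?thesis using eq ab by simp
qed

end

section \<open>Fractions as preordered groups and as normal subgroups\<close>

lemma fractions_preordered_group:
  assumes "invariant_submonoid P G"
  shows "preordered_group (G\<lparr>carrier := fractions G P\<rparr>, P)"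
proof -
  interpret invariant_submonoid P G by fact
  have "submonoid P (G\<lparr>carrier := fractions G P\<rparr>)"
    using P_fractions P_mult P_one by (intro submonoid.intro) simp_all
  moreover have "x \<otimes>\<^bsub>G\<^esub> p \<otimes>\<^bsub>G\<^esub> inv\<^bsub>G\<lparr>carrier := fractions G P\<rparr>\<^esub> x \<in> P" if "x \<in> fractions G P" "p \<in> P" for x p
    using fractions_cone[OF that] fractions_inv[OF that(1)] by simp
  ultimately show ?thesis using fractions_group by (simp add: preordered_group_def)
qed

lemma preordered_group_invariant_submonoid:
  assumes "preordered_group (G, P)"
  shows "invariant_submonoid P G"
proof -
  have P: "submonoid P G"
    and conj: "\<And>g x. g \<in> carrier G \<Longrightarrow> x \<in> P \<Longrightarrow> g \<otimes>\<^bsub>G\<^esub> x \<otimes>\<^bsub>G\<^esub> inv\<^bsub>G\<^esub> g \<in> P"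
    using assms by (auto simp: preordered_group_def)
  interpret group G using assms by (auto simp: preordered_group_def)
  interpret submonoid P G by fact
  show ?thesis
  proof unfold_locales
    fix a b assume ab: "a \<in> P" "b \<in> P"
    show "a \<otimes>\<^bsub>G\<^esub> b \<otimes>\<^bsub>G\<^esub> inv\<^bsub>G\<^esub> a \<in> P" using conj ab by simp
    show "inv\<^bsub>G\<^esub> a \<otimes>\<^bsub>G\<^esub> b \<otimes>\<^bsub>G\<^esub> a \<in> P" using conj[of "inv\<^bsub>G\<^esub> a" b] ab by simp
  qed
qed

text \<open>Conjugating a fraction conjugates its numerator and denominator, and the cone is closed
  under conjugation by all of \<open>G\<close>. Normality makes the hypothesis
  \<open>preserves_cone_quotients\<close> applicable.\<close>

lemma fractions_normal:
  assumes "preordered_group (G, P)"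
  shows "fractions G P \<lhd> G"
proof -
  interpret invariant_submonoid P G by (rule preordered_group_invariant_submonoid) fact
  have conj: "\<And>g x. g \<in> carrier G \<Longrightarrow> x \<in> P \<Longrightarrow> g \<otimes>\<^bsub>G\<^esub> x \<otimes>\<^bsub>G\<^esub> inv\<^bsub>G\<^esub> g \<in> P"
    using assms by (auto simp: preordered_group_def)
  have "g \<otimes>\<^bsub>G\<^esub> x \<otimes>\<^bsub>G\<^esub> inv\<^bsub>G\<^esub> g \<in> fractions G P" if g: "g \<in> carrier G" and x: "x \<in> fractions G P" for g x
  proof -
    obtain a b where ab: "a \<in> P" "b \<in> P" "x = a \<otimes>\<^bsub>G\<^esub> inv\<^bsub>G\<^esub> b" using x by (rule fractions_cases)
    have "g \<otimes>\<^bsub>G\<^esub> x \<otimes>\<^bsub>G\<^esub> inv\<^bsub>G\<^esub> g = (g \<otimes>\<^bsub>G\<^esub> a \<otimes>\<^bsub>G\<^esub> inv\<^bsub>G\<^esub> g) \<otimes>\<^bsub>G\<^esub> inv\<^bsub>G\<^esub> (g \<otimes>\<^bsub>G\<^esub> b \<otimes>\<^bsub>G\<^esub> inv\<^bsub>G\<^esub> g)"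
      using ab g by (simp add: inv_mult_group m_assoc inv_cancel_left)
    then show ?thesis using fractionsI[OF conj[OF g ab(1)] conj[OF g ab(2)]] by simp
  qed
  then show ?thesis using fractions_subgroup by (simp add: normal_inv_iff)
qed

section \<open>The positive cone functor\<close>

lemma PreOrdGrp_Hom:
  "m \<in> Hom PreOrdGrp (G, P) (H, Q) \<longleftrightarrow> (\<exists>f. m = MapArrow (G, P) f (H, Q) \<and>
     preordered_group (G, P) \<and> preordered_group (H, Q) \<and> f \<in> hom G H \<and> f ` P \<subseteq> Q \<and>
     f \<in> extensional (carrier G))"
  by (auto simp: Hom_def PreOrdGrp_def concrete_cat_def)

lemma PreOrdGrp_Ob [simp]: "A \<in> Ob PreOrdGrp \<longleftrightarrow> preordered_group A"
  by (simp add: PreOrdGrp_def concrete_cat_def)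

lemma MonGe0_Hom:
  "m \<in> Hom MonGe0 M N \<longleftrightarrow> (\<exists>f. m = MapArrow M f N \<and> M \<in> Ob MonGe0 \<and> N \<in> Ob MonGe0 \<and>
     f \<in> hom M N \<and> f \<one>\<^bsub>M\<^esub> = \<one>\<^bsub>N\<^esub> \<and> f \<in> extensional (carrier M))"
  by (auto simp: Hom_def MonGe0_def concrete_cat_def)

lemma MonGe0_Comp: "Comp MonGe0 (MapArrow N g K) (MapArrow M f N') = MapArrow M (compose (carrier M) g f) K"
  by (simp add: MonGe0_def concrete_cat_def)

lemma MonGe0_Ident: "Ident MonGe0 M = MapArrow M (\<lambda>x\<in>carrier M. x) M"
  by (simp add: MonGe0_def concrete_cat_def)

lemma PosCone_MapArrow:
  "on_ar PosCone (MapArrow (G, P) f (H, Q)) = MapArrow (G\<lparr>carrier := P\<rparr>) (restrict f P) (H\<lparr>carrier := Q\<rparr>)"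
  by (simp add: PosCone_def cone_monoid_def)

lemma PosCone_ob [simp]: "on_ob PosCone (G, P) = G\<lparr>carrier := P\<rparr>"
  by (simp add: PosCone_def cone_monoid_def)

lemma MonGe0_iso:
  assumes M: "M \<in> Ob MonGe0" and N: "N \<in> Ob MonGe0"
    and f: "f \<in> hom M N" "f \<one>\<^bsub>M\<^esub> = \<one>\<^bsub>N\<^esub>" "bij_betw f (carrier M) (carrier N)"
  shows "MapArrow M (restrict f (carrier M)) N \<in> Hom MonGe0 M N"
    and "is_iso MonGe0 (MapArrow M (restrict f (carrier M)) N)"
proof -
  interpret C: categ "MonGe0 :: ('a monoid, ('a monoid, 'a) map_arrow) cat"
    by (rule categ.intro) (rule MonGe0_category)
  have "monoid M" "monoid N" using M N by (auto simp: MonGe0_def concrete_cat_def)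
  then interpret M: monoid M + N: monoid N by simp_all
  define g where "g = inv_into (carrier M) f"
  have g: "g y \<in> carrier M" "f (g y) = y" if "y \<in> carrier N" for y
    using f(3) that by (auto simp: g_def bij_betw_def inv_into_into f_inv_into_f)
  have gf: "g (f x) = x" if "x \<in> carrier M" for x
    using f(3) that by (auto simp: g_def bij_betw_def)
  have fc: "f x \<in> carrier N" if "x \<in> carrier M" for x using f(1) that by (rule hom_in_carrier)
  have fm: "f (x \<otimes>\<^bsub>M\<^esub> y) = f x \<otimes>\<^bsub>N\<^esub> f y" if "x \<in> carrier M" "y \<in> carrier M" for x y
    using f(1) that by (rule hom_mult)
  have "g (x \<otimes>\<^bsub>N\<^esub> y) = g x \<otimes>\<^bsub>M\<^esub> g y" if "x \<in> carrier N" "y \<in> carrier N" for x y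
    using gf[of "g x \<otimes>\<^bsub>M\<^esub> g y"] fm[of "g x" "g y"] g that by simp
  then have ghom: "restrict g (carrier N) \<in> hom N M" using g by (intro homI) simp_all
  have g1: "g \<one>\<^bsub>N\<^esub> = \<one>\<^bsub>M\<^esub>" using gf[of "\<one>\<^bsub>M\<^esub>"] f(2) by simp
  have fhom: "restrict f (carrier M) \<in> hom M N" using fc fm by (intro homI) simp_all
  show a: "MapArrow M (restrict f (carrier M)) N \<in> Hom MonGe0 M N"
    using fhom M N f(2) by (simp add: MonGe0_Hom)
  have b: "MapArrow N (restrict g (carrier N)) M \<in> Hom MonGe0 N M"
    using ghom M N g1 by (simp add: MonGe0_Hom)
  show "is_iso MonGe0 (MapArrow M (restrict f (carrier M)) N)"
    by (rule C.isoI[OF a b])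
      (auto simp: MonGe0_Comp MonGe0_Ident compose_def gf g fc fun_eq_iff)
qed

text \<open>Injectivity of \<open>PosCone\<close> on these morphisms is uniqueness of extensions to
  fractions, and surjectivity is their existence. The extension is positive because it agrees on
  \<open>P\<close> with a map into \<open>Q\<close>.\<close>

lemma fractions_coreflective:
  assumes G: "preordered_group (G, P)" and frac: "carrier G = fractions G P"
  shows "coreflective_ob PreOrdGrp MonGe0 PosCone (G, P)"
  unfolding coreflective_ob_def
proof (intro conjI ballI)
  show "(G, P) \<in> Ob PreOrdGrp" using G by simp
  fix A :: "'a preord_grp" assume "A \<in> Ob PreOrdGrp"
  moreover obtain H Q where A: "A = (H, Q)" by fastforce
  ultimately have H: "preordered_group (H, Q)" by simp
  then have gH: "group H" and QH: "Q \<subseteq> carrier H"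
    using submonoid.subset by (auto simp: preordered_group_def)
  interpret invariant_submonoid P G by (rule preordered_group_invariant_submonoid[OF G])
  \<comment> \<open>The extension lemmas speak of the record whose carrier is the set of fractions;
    by \<open>frac\<close> it is \<open>G\<close> itself.\<close>
  have "G\<lparr>carrier := fractions G P\<rparr> = G\<lparr>carrier := carrier G\<rparr>" by (simp only: frac)
  then have Geq: "G\<lparr>carrier := fractions G P\<rparr> = G" by simp
  show "bij_betw (on_ar PosCone) (Hom PreOrdGrp (G, P) A)
      (Hom MonGe0 (on_ob PosCone (G, P)) (on_ob PosCone A))"
    unfolding bij_betw_def A
  proof (intro conjI inj_onI equalityI subsetI)
    fix m n assume m: "m \<in> Hom PreOrdGrp (G, P) (H, Q)" and n: "n \<in> Hom PreOrdGrp (G, P) (H, Q)"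
      and eq: "on_ar PosCone m = on_ar PosCone n"
    obtain f where f: "m = MapArrow (G, P) f (H, Q)" "f \<in> hom G H" "f \<in> extensional (carrier G)"
      using m unfolding PreOrdGrp_Hom by (elim exE conjE)
    obtain g where g: "n = MapArrow (G, P) g (H, Q)" "g \<in> hom G H" "g \<in> extensional (carrier G)"
      using n unfolding PreOrdGrp_Hom by (elim exE conjE)
    have "f x = g x" if "x \<in> P" for x
    proof -
      have "restrict f P = restrict g P" using eq by (simp add: f(1) g(1) PosCone_MapArrow)
      then have "restrict f P x = restrict g P x" by simp
      then show ?thesis using that by simp
    qed
    then have "f x = g x" if "x \<in> carrier G" for x
      using hom_fractions_unique[OF gH, unfolded Geq, OF f(2) g(2)] that unfolding frac by blast
    then have "f = g" by (rule extensionalityI[OF f(3) g(3)])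
    then show "m = n" by (simp add: f(1) g(1))
  next
    fix m assume "m \<in> on_ar PosCone ` Hom PreOrdGrp (G, P) (H, Q)"
    then show "m \<in> Hom MonGe0 (on_ob PosCone (G, P)) (on_ob PosCone (H, Q))"
      using functor_Hom[OF PosCone_functor] by blast
  next
    fix m assume "m \<in> Hom MonGe0 (on_ob PosCone (G, P)) (on_ob PosCone (H, Q))"
    then obtain f where m: "m = MapArrow (G\<lparr>carrier := P\<rparr>) f (H\<lparr>carrier := Q\<rparr>)"
      and f: "f \<in> hom (G\<lparr>carrier := P\<rparr>) (H\<lparr>carrier := Q\<rparr>)" "f \<in> extensional P"
      unfolding MonGe0_Hom PosCone_ob by auto
    \<comment> \<open>The codomain is enlarged from the cone to the group \<open>H\<close>, where
      the values of \<open>f\<close> have inverses.\<close>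
    have "f \<in> hom (G\<lparr>carrier := P\<rparr>) H" using f(1) QH by (auto simp: hom_def)
    then obtain h where h: "h \<in> hom G H" "\<And>x. x \<in> P \<Longrightarrow> h x = f x"
      using hom_fractions_extend[OF gH] unfolding Geq by blast
    have "restrict h (carrier G) \<in> hom G H"
      using hom_in_carrier[OF h(1)] hom_mult[OF h(1)] by (intro homI) simp_all
    moreover have "restrict h (carrier G) ` P \<subseteq> Q" using h(2) f(1) by (auto simp: hom_def)
    ultimately have "MapArrow (G, P) (restrict h (carrier G)) (H, Q) \<in> Hom PreOrdGrp (G, P) (H, Q)"
      using G H by (simp add: PreOrdGrp_Hom)
    moreover have "restrict (restrict h (carrier G)) P = f"
      using h(2) f(2) by (intro extensionalityI[of _ P]) auto
    then have "on_ar PosCone (MapArrow (G, P) (restrict h (carrier G)) (H, Q)) = m"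
      by (simp add: PosCone_MapArrow m)
    ultimately show "m \<in> on_ar PosCone ` Hom PreOrdGrp (G, P) (H, Q)" by blast
  qed
qed

lemma fractions_subgroup_coreflective:
  assumes "invariant_submonoid P G"
  shows "coreflective_ob PreOrdGrp MonGe0 PosCone (G\<lparr>carrier := fractions G P\<rparr>, P)"
  using fractions_coreflective[OF fractions_preordered_group[OF assms]]
    invariant_submonoid.fractions_idem[OF assms] by simp

text \<open>Embed \<open>M\<close> in a group and let \<open>P\<close> be its image. The exchange
  condition makes \<open>P\<close> invariant under its own elements, so \<open>M\<close> is
  isomorphic to the cone of the group of fractions of \<open>P\<close>.\<close>

lemma PosCone_essentially_surjective:
  assumes M: "M \<in> Ob MonGe0"
  shows "\<exists>Y e. coreflective_ob PreOrdGrp MonGe0 PosCone Y \<and> e \<in> Hom MonGe0 M (on_ob PosCone Y) \<and> is_iso MonGe0 e"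
proof -
  have "monoid M" and emb: "embeddable_in_group M"
    and ore: "\<And>a b. a \<in> carrier M \<Longrightarrow> b \<in> carrier M \<Longrightarrow> \<exists>x\<in>carrier M. \<exists>y\<in>carrier M.
            a \<otimes>\<^bsub>M\<^esub> b = b \<otimes>\<^bsub>M\<^esub> x \<and> a \<otimes>\<^bsub>M\<^esub> b = y \<otimes>\<^bsub>M\<^esub> a"
    using M by (auto simp: MonGe0_def concrete_cat_def)
  interpret M: monoid M by fact
  obtain G :: "'a monoid" and f where "group G" and f: "f \<in> hom M G" "f \<one>\<^bsub>M\<^esub> = \<one>\<^bsub>G\<^esub>" "inj_on f (carrier M)"
    using emb unfolding embeddable_in_group_def by blast
  interpret group G by fact
  define P where "P = f ` carrier M"
  note fc = hom_in_carrier[OF f(1)] and fm = hom_mult[OF f(1)]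
  have "submonoid P G"
  proof
    show "P \<subseteq> carrier G" using fc by (auto simp: P_def)
    show "\<one>\<^bsub>G\<^esub> \<in> P" using f(2) M.one_closed imageI[of "\<one>\<^bsub>M\<^esub>" "carrier M" f] by (simp add: P_def)
    show "x \<otimes>\<^bsub>G\<^esub> y \<in> P" if "x \<in> P" "y \<in> P" for x y
      using that fm[symmetric] M.m_closed by (auto simp: P_def)
  qed
  moreover have "f a \<otimes>\<^bsub>G\<^esub> f b \<otimes>\<^bsub>G\<^esub> inv\<^bsub>G\<^esub> f a \<in> P" "inv\<^bsub>G\<^esub> f a \<otimes>\<^bsub>G\<^esub> f b \<otimes>\<^bsub>G\<^esub> f a \<in> P"
    if ab: "a \<in> carrier M" "b \<in> carrier M" for a b
  proof -
    obtain y where y: "y \<in> carrier M" "a \<otimes>\<^bsub>M\<^esub> b = y \<otimes>\<^bsub>M\<^esub> a" using ore[OF ab] by blast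
    have "f a \<otimes>\<^bsub>G\<^esub> f b = f y \<otimes>\<^bsub>G\<^esub> f a" using y(2) fm[OF ab] fm[OF y(1) ab(1)] by simp
    then have "f a \<otimes>\<^bsub>G\<^esub> f b \<otimes>\<^bsub>G\<^esub> inv\<^bsub>G\<^esub> f a = f y" using fc ab y(1) by (simp add: m_assoc)
    then show "f a \<otimes>\<^bsub>G\<^esub> f b \<otimes>\<^bsub>G\<^esub> inv\<^bsub>G\<^esub> f a \<in> P" using y(1) by (simp add: P_def)
    \<comment> \<open>Here the exchange condition is applied with \<open>a\<close> and
      \<open>b\<close> swapped, which yields conjugation by the inverse of
      \<open>f a\<close>.\<close>
    obtain x where x: "x \<in> carrier M" "b \<otimes>\<^bsub>M\<^esub> a = a \<otimes>\<^bsub>M\<^esub> x" using ore[OF ab(2,1)] by blast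
    have "f b \<otimes>\<^bsub>G\<^esub> f a = f a \<otimes>\<^bsub>G\<^esub> f x" using x(2) fm[OF ab(2,1)] fm[OF ab(1) x(1)] by simp
    then have "inv\<^bsub>G\<^esub> f a \<otimes>\<^bsub>G\<^esub> f b \<otimes>\<^bsub>G\<^esub> f a = f x" using fc ab x(1) by (simp add: m_assoc inv_cancel_left)
    then show "inv\<^bsub>G\<^esub> f a \<otimes>\<^bsub>G\<^esub> f b \<otimes>\<^bsub>G\<^esub> f a \<in> P" using x(1) by (simp add: P_def)
  qed
  ultimately have P: "invariant_submonoid P G"
    by (intro invariant_submonoid.intro invariant_submonoid_axioms.intro is_group) (auto simp: P_def)
  let ?Y = "(G\<lparr>carrier := fractions G P\<rparr>, P)"
  have N: "G\<lparr>carrier := P\<rparr> \<in> Ob MonGe0"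
    using functor_ob[OF PosCone_functor, of ?Y] fractions_preordered_group[OF P] by simp
  have hom: "f \<in> hom M (G\<lparr>carrier := P\<rparr>)" using fm by (auto simp: hom_def P_def)
  have bij: "bij_betw f (carrier M) (carrier (G\<lparr>carrier := P\<rparr>))" using f(3) by (simp add: bij_betw_def P_def)
  have one: "f \<one>\<^bsub>M\<^esub> = \<one>\<^bsub>G\<lparr>carrier := P\<rparr>\<^esub>" using f(2) by simp
  show ?thesis
    using fractions_subgroup_coreflective[OF P] MonGe0_iso[OF M N hom one bij]
    by (intro exI[of _ ?Y] exI conjI) simp_all
qed

section \<open>Inverting the inclusion of the group of fractions\<close>

lemma trivial_cone_preordered_group:
  assumes "group Q"
  shows "preordered_group (Q, {\<one>\<^bsub>Q\<^esub>})"
proof -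
  interpret group Q by fact
  have "submonoid {\<one>\<^bsub>Q\<^esub>} Q" by (rule submonoid.intro) simp_all
  then show ?thesis by (simp add: preordered_group_def is_group)
qed

text \<open>A trivial cone is both a group and reduced, so the identity of the image goes from a
  torsion object to a torsion-free one.\<close>

lemma trivial_cone_zero:
  assumes C: "is_category C" and tt: "torsion_theory C \<T> \<F>" and F: "is_functor PreOrdGrp C F"
    and ttf: "torsion_theory_functor C \<T> \<F> F" and Q: "group Q"
  shows "zero_morphism C (Ident C (on_ob F (Q, {\<one>\<^bsub>Q\<^esub>})))"
proof -
  interpret group Q by fact
  let ?Z = "(Q, {\<one>\<^bsub>Q\<^esub>})"
  have Z: "preordered_group ?Z" using trivial_cone_preordered_group[OF Q] .
  have "group (Q\<lparr>carrier := {\<one>\<^bsub>Q\<^esub>}\<rparr>)"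
    by (rule subgroup.subgroup_is_group[OF triv_subgroup is_group])
  then have "?Z \<in> GrpPreOrd" "?Z \<in> ParOrdGrp" using Z by (simp_all add: GrpPreOrd_def ParOrdGrp_def)
  moreover have "\<forall>A\<in>GrpPreOrd. on_ob F A \<in> \<T>" "\<forall>A\<in>ParOrdGrp. on_ob F A \<in> \<F>"
    using ttf unfolding torsion_theory_functor_def by simp_all
  ultimately have Fob: "on_ob F ?Z \<in> \<T>" "on_ob F ?Z \<in> \<F>" by simp_all
  have "Ident C (on_ob F ?Z) \<in> Hom C (on_ob F ?Z) (on_ob F ?Z)"
    using categ.ident_Hom[OF categ.intro[OF C]] functor_ob[OF F, of ?Z] Z by simp
  moreover have "\<forall>A\<in>\<T>. \<forall>B\<in>\<F>. \<forall>f\<in>Hom C A B. zero_morphism C f"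
    using tt unfolding torsion_theory_def by (elim conjE)
  ultimately show ?thesis using Fob by blast
qed

lemma fractions_inclusion_iso:
  assumes C: "is_category C" and tt: "torsion_theory C \<T> \<F>" and F: "is_functor PreOrdGrp C F"
    and ttf: "torsion_theory_functor C \<T> \<F> F" and pres: "preserves_cone_quotients C F"
    and G: "preordered_group (G, P)"
  shows "is_iso C (on_ar F (inclusion_arrow (G\<lparr>carrier := fractions G P\<rparr>, P) (G, P)))"
proof -
  interpret C: categ C by (rule categ.intro) fact
  interpret invariant_submonoid P G by (rule preordered_group_invariant_submonoid[OF G])
  let ?H = "fractions G P"
  let ?Q = "quotient_group G ?H"
  let ?q = "quotient_arrow (G, P) ?H {\<one>\<^bsub>?Q\<^esub>}"
  have H: "?H \<lhd> G" by (rule fractions_normal[OF G])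
  have Q: "group ?Q" using coset_rep_group_hom[OF H] by (simp add: group_hom_def)
  \<comment> \<open>The image of \<open>P\<close> in the quotient is the trivial cone because
    \<open>P\<close> consists of fractions, so this is the usual quotient morphism.\<close>
  have q: "?q \<in> Hom PreOrdGrp (G, P) (?Q, {\<one>\<^bsub>?Q\<^esub>})"
    using quotient_arrow_PreOrdGrp[OF G H] coset_rep_trivial_cone[OF G H P_fractions] by simp
  have "short_exact C (on_ar F (inclusion_arrow (G\<lparr>carrier := ?H\<rparr>, P) (G, P))) (on_ar F ?q)"
    using pres[unfolded preserves_cone_quotients_def, rule_format, of G P ?H] G H P_fractions by simp
  moreover have "zero_morphism C (on_ar F ?q)"
    using C.zero_morphism_codI[OF functor_Hom[OF F q] trivial_cone_zero[OF C tt F ttf Q]] .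
  ultimately show ?thesis unfolding short_exact_def by (intro C.kernel_of_zero_iso) (elim conjE)
qed

theorem theorem5p1:
  fixes C :: "('o, 'm) cat"
    and \<T> \<F> :: "'o set"
    and F :: "('u preord_grp, ('u preord_grp, 'u) map_arrow, 'o, 'm) functor_data"
  assumes "pointed_category C"
    and "torsion_theory C \<T> \<F>"
    and "is_functor PreOrdGrp C F"
    and "torsion_theory_functor C \<T> \<F> F"
    and "preserves_cone_quotients C F"
  shows "\<exists>F'. is_functor MonGe0 C F' \<and>
              naturally_isomorphic PreOrdGrp C (functor_comp F' PosCone) F \<and>
              (\<forall>F''. is_functor MonGe0 C F'' \<and>
                     naturally_isomorphic PreOrdGrp C (functor_comp F'' PosCone) F \<longrightarrow>
                     naturally_isomorphic MonGe0 C F' F'')"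
proof (rule factorisation_through_coreflection)
  show C: "is_category C" using assms(1) by (simp add: pointed_category_def)
  show "is_category (PreOrdGrp :: ('u preord_grp, ('u preord_grp, 'u) map_arrow) cat)"
    by (rule PreOrdGrp_category)
  show Mon: "is_category (MonGe0 :: ('u monoid, ('u monoid, 'u) map_arrow) cat)"
    by (rule MonGe0_category)
  show "is_functor PreOrdGrp MonGe0
      (PosCone :: ('u preord_grp, ('u preord_grp, 'u) map_arrow, 'u monoid, ('u monoid, 'u) map_arrow) functor_data)"
    by (rule PosCone_functor)
  show "is_functor PreOrdGrp C F" by fact
  show "\<exists>Y e. coreflective_ob PreOrdGrp MonGe0 PosCone Y \<and> e \<in> Hom MonGe0 M (on_ob PosCone Y) \<and> is_iso MonGe0 e"
    if "M \<in> Ob MonGe0" for M :: "'u monoid"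
    using that by (rule PosCone_essentially_surjective)
  show "\<exists>Y j. coreflective_ob PreOrdGrp MonGe0 PosCone Y \<and> j \<in> Hom PreOrdGrp Y A \<and>
      is_iso MonGe0 (on_ar PosCone j) \<and> is_iso C (on_ar F j)"
    if "A \<in> Ob PreOrdGrp" for A :: "'u preord_grp"
  proof -
    obtain G P where A: "A = (G, P)" by fastforce
    with that have G: "preordered_group (G, P)" by simp
    interpret invariant_submonoid P G by (rule preordered_group_invariant_submonoid[OF G])
    let ?Y = "(G\<lparr>carrier := fractions G P\<rparr>, P)"
    let ?j = "inclusion_arrow ?Y (G, P)"
    have j: "?j \<in> Hom PreOrdGrp ?Y (G, P)"
      by (rule inclusion_arrow_normal_PreOrdGrp[OF G fractions_normal[OF G] P_fractions])
    \<comment> \<open>Passing to the group of fractions leaves the cone unchanged, so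
      \<open>PosCone\<close> sends the inclusion to an identity.\<close>
    have "restrict (\<lambda>x\<in>fractions G P. x) P = (\<lambda>x\<in>P. x)"
      using P_fractions by (auto simp: fun_eq_iff)
    then have "on_ar PosCone ?j = Ident MonGe0 (on_ob PosCone (G, P))"
      by (simp add: inclusion_arrow_def PosCone_MapArrow MonGe0_Ident)
    then have "is_iso MonGe0 (on_ar PosCone ?j)"
      using categ.ident_iso[OF categ.intro[OF Mon]] functor_ob[OF PosCone_functor, of "(G, P)"] G by simp
    then show ?thesis
      using fractions_subgroup_coreflective[OF preordered_group_invariant_submonoid[OF G]] j
        fractions_inclusion_iso[OF C assms(2-5) G]
      unfolding A by (intro exI conjI)
  qed
qed

end
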